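(* Let $\ell\ge1$, let $q_1,\dots,q_\ell\ge1$ be pairwise co-prime natural numbers and let $k>1$ be an integer. Let $\mathbf{K}\subset\mathbb{C}$ be a number field such that $\mathbf{K}\cap\mathbb{Q}(\zeta_{q_1\cdots q_\ell})^{+}=\mathbb{Q}$. Then $$\dim_{\mathbf{K}}\Big(\sum_{j=1}^{\ell}V^+_{\mathbf{K},k}(q_j)\Big)=\sum_{j=1}^{\ell}\dim_{\mathbf{K}}\big(V^+_{\mathbf{K},k}(q_j)\big)-(\ell-1)\dim_{\mathbf{K}}\big(V^+_{\mathbf{K},k}(1)\big).$$ In particular, $$\dim_{\mathbf{K}}\Big(\sum_{j=1}^{\ell}V^+_{\mathbf{K},k}(q_j)\Big)=\begin{cases}\sum_{j=1}^{\ell}\frac{\varphi(q_j)}{2}-\frac{\ell-1}{2}(1+(-1)^k) & \text{if } 2<q_1,\dots,q_\ell,\\[1mm] \sum_{j=2}^{\ell}\frac{\varphi(q_j)}{2}-\frac{\ell-2}{2}(1+(-1)^k) & \text{if } 2=q_1<q_2,\dots,q_\ell.\end{cases}$$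
   Context: $\zeta_n$ is a primitive $n$-th root of unity, $\mathbb{Q}(\zeta_n)^+=\mathbb{Q}(\zeta_n)\cap\mathbb{R}$, and $\varphi$ is Euler's totient function. The Hurwitz zeta function is $\zeta(s,x)=\sum_{n\ge0}(n+x)^{-s}$ for $0<x\le1$, $\Re(s)>1$; note $\zeta(k,1)=\zeta(k)$. For a number field $\mathbf{K}\subset\mathbb{C}$ and integers $k>1$, $q>2$, $$V^{+}_{\mathbf{K},k}(q)=\sum_{1\le a<q/2,\ (a,q)=1}\mathbf{K}\big(\zeta(k,a/q)+(-1)^k\zeta(k,1-a/q)\big)\subset\mathbb{C},$$ while $V^{+}_{\mathbf{K},k}(2)=\mathbf{K}\,\zeta(k,1/2)(1+(-1)^k)$ and $V^{+}_{\mathbf{K},k}(1)=\mathbf{K}\,\zeta(k,1)(1+(-1)^k)$. *)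

theory Defs
  imports "HOL-Analysis.Analysis" "HOL-Number_Theory.Number_Theory"
begin

definition subfield_C :: "complex set \<Rightarrow> bool" where
  "subfield_C K \<longleftrightarrow> 0 \<in> K \<and> 1 \<in> K \<and>
     (\<forall>x\<in>K. \<forall>y\<in>K. x + y \<in> K \<and> x * y \<in> K) \<and>
     (\<forall>x\<in>K. - x \<in> K \<and> inverse x \<in> K)"

definition K_span :: "complex set \<Rightarrow> complex set \<Rightarrow> complex set" where
  "K_span K S = {(\<Sum>v\<in>F. c v * v) | F c. finite F \<and> F \<subseteq> S \<and> (\<forall>v\<in>F. c v \<in> K)}"

definition K_indep :: "complex set \<Rightarrow> complex set \<Rightarrow> bool" where
  "K_indep K S \<longleftrightarrow> (\<forall>F c. finite F \<and> F \<subseteq> S \<and> (\<forall>v\<in>F. c v \<in> K) \<and>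
       (\<Sum>v\<in>F. c v * v) = 0 \<longrightarrow> (\<forall>v\<in>F. c v = 0))"

definition K_basis :: "complex set \<Rightarrow> complex set \<Rightarrow> complex set \<Rightarrow> bool" where
  "K_basis K V B \<longleftrightarrow> finite B \<and> K_indep K B \<and> K_span K B = V"

text \<open>Dimension over K (of a finite-dimensional K-subspace; 0 by convention otherwise).\<close>
definition K_dim :: "complex set \<Rightarrow> complex set \<Rightarrow> nat" where
  "K_dim K V = (if \<exists>B. K_basis K V B then card (SOME B. K_basis K V B) else 0)"

definition number_field :: "complex set \<Rightarrow> bool" where
  "number_field K \<longleftrightarrow> subfield_C K \<and> (\<exists>B. finite B \<and> K_span \<rat> B = K)"

definition zeta_n :: "nat \<Rightarrow> complex" where
  "zeta_n n = cis (2 * pi / real n)"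

definition cyclotomic_field :: "nat \<Rightarrow> complex set" where
  "cyclotomic_field n = \<Inter>{F. subfield_C F \<and> zeta_n n \<in> F}"

definition cyclotomic_plus :: "nat \<Rightarrow> complex set" where
  "cyclotomic_plus n = cyclotomic_field n \<inter> \<real>"

definition hurwitz_zeta :: "nat \<Rightarrow> real \<Rightarrow> real" where
  "hurwitz_zeta k x = (\<Sum>n. 1 / (real n + x) ^ k)"

definition Vplus :: "complex set \<Rightarrow> nat \<Rightarrow> nat \<Rightarrow> complex set" where
  "Vplus K k q =
    (if q > 2 then
       K_span K {complex_of_real (hurwitz_zeta k (real a / real q)
                   + (-1) ^ k * hurwitz_zeta k (1 - real a / real q))
                 | a. 1 \<le> a \<and> real a < real q / 2 \<and> coprime a q}
     else if q = 2 then
       K_span K {complex_of_real (hurwitz_zeta k (1/2) * (1 + (-1) ^ k))}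
     else
       K_span K {complex_of_real (hurwitz_zeta k 1 * (1 + (-1) ^ k))})"

end

theory Submission
  imports Defs "Jordan_Normal_Form.Char_Poly"
begin

text \<open>
  Put \<open>C\<^sub>q(a) = \<zeta>(k, a/q) + (-1)\<^sup>k \<zeta>(k, 1 - a/q)\<close>. Differentiating the cotangent, \<open>C\<^sub>q(a)\<close> is
  \<open>(2\<pi>\<i>)\<^sup>k\<close> times the value of a fixed rational function over \<open>\<rat>\<close> at
  \<open>\<zeta>\<^sub>q\<^sup>a\<close>. As \<open>K\<close> and \<open>\<rat>(\<zeta>\<^sub>N)\<^sup>+\<close> are linearly disjoint, a \<open>K\<close>-linear relation
  \<open>\<Sum>\<^sub>q \<Sum>\<^sub>a c\<^sub>q(a) C\<^sub>q(a) = 0\<close> remains valid after replacing every \<open>a\<close> by \<open>ah\<close>, for each \<open>h\<close> prime to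
  \<open>N = \<Prod>q\<close>. By the Chinese remainder theorem the inner sums \<open>\<Sum>\<^sub>a c\<^sub>q(a) C\<^sub>q(ah)\<close> are then constant
  in \<open>h\<close>. Subtracting a multiple of the relation \<open>\<Sum>\<^sub>a C\<^sub>q(a) \<in> \<rat> \<zeta>(k)\<close> (available for even \<open>k\<close> only; for
  odd \<open>k\<close> the constant is \<open>0\<close>), it remains to see that the matrix \<open>C\<^sub>q(ah)\<close> is invertible, which
  follows from diagonal dominance because \<open>\<zeta>(k) \<le> 2\<close>. So the only relations are those that identify
  the copies of \<open>\<zeta>(k)\<close> in the different spaces.
\<close>

section \<open>Conjugates of roots of unity\<close>

text \<open>Independence inside a single space is classically read off from the nonvanishing of L(k,
  chi) for all characters modulo q with the parity of k; the dominance argument replaces this by the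
  bound zeta(k) <= 2 and uses no characters. Two points shape the rest. Only the real subfield is
  assumed to be disjoint from \<open>K\<close>, while for odd k the algebraic part of C_q(a) changes
  sign when the root of unity is inverted; such relations are first multiplied by zeta - 1/zeta. And
  no field automorphism is constructed: replacing a by ah is carried out on polynomials, using that
  a rational polynomial that vanishes at w, where w^N = 1, also vanishes at w^h for h prime to N.
  The moduli 1 and 2 only give the multiples of zeta(k), or 0 for odd k. Every space of a larger
  modulus contains these already, which is where the correction (l - 1) dim V(1) comes from.\<close>

lemma root_of_unity_power_mod:
  fixes w :: "'a :: comm_monoid_mult"
  assumes "w ^ N = 1"
  shows "w ^ (m mod N) = w ^ m"
proof -
  have "w ^ m = w ^ (N * (m div N) + m mod N)" by simp
  also have "\<dots> = w ^ (m mod N)"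
    unfolding power_add power_mult by (simp add: assms)
  finally show ?thesis by simp
qed

text \<open>The powers 1, w, ..., w^(N-1) form an eigenvector, with eigenvalue s(w), of the integer
  matrix \<open>A\<close> that describes multiplication by s(w) with exponents reduced modulo N. Its
  characteristic polynomial is monic and integral.\<close>

lemma algebraic_int_poly_root_of_unity:
  fixes w :: complex and s :: "int poly"
  assumes N: "N > 0" and w: "w ^ N = 1"
  shows "algebraic_int (poly (map_poly of_int s) w)"
proof -
  define x where "x = poly (map_poly of_int s) w"
  define a where "a i j = (\<Sum>m\<le>degree s. if (i + m) mod N = j then poly.coeff s m else 0)" for i j
  define A where "A = mat N N (\<lambda>(i,j). a i j)"
  define B where "B = (map_mat of_int A :: complex mat)"
  define v where "v = vec N (\<lambda>j. w ^ j)"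
  have A: "A \<in> carrier_mat N N" and B: "B \<in> carrier_mat N N"
    by (auto simp: A_def B_def)
  note wmod = root_of_unity_power_mod[OF w]
  have x: "x = (\<Sum>m\<le>degree s. of_int (poly.coeff s m) * w ^ m)"
    by (simp add: x_def poly_altdef degree_map_poly coeff_map_poly)
  have "B *\<^sub>v v = x \<cdot>\<^sub>v v"
  proof (rule eq_vecI)
    fix i assume "i < dim_vec (x \<cdot>\<^sub>v v)"
    hence i: "i < N" by (simp add: v_def)
    have "(B *\<^sub>v v) $ i = (\<Sum>j<N. of_int (a i j) * w ^ j)"
      using i by (simp add: B_def A_def v_def scalar_prod_def lessThan_atLeast0)
    also have "\<dots> = (\<Sum>j<N. \<Sum>m\<le>degree s.
        if (i + m) mod N = j then of_int (poly.coeff s m) * w ^ ((i + m) mod N) else 0)"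
      unfolding a_def of_int_sum sum_distrib_right by (intro sum.cong refl) auto
    also have "\<dots> = (\<Sum>m\<le>degree s. \<Sum>j<N.
        if (i + m) mod N = j then of_int (poly.coeff s m) * w ^ ((i + m) mod N) else 0)"
      by (rule sum.swap)
    also have "\<dots> = (\<Sum>m\<le>degree s. of_int (poly.coeff s m) * w ^ ((i + m) mod N))"
      using N by (intro sum.cong refl) (simp add: sum.delta')
    also have "\<dots> = x * w ^ i"
      unfolding wmod x sum_distrib_right by (simp add: power_add mult_ac)
    finally show "(B *\<^sub>v v) $ i = (x \<cdot>\<^sub>v v) $ i"
      using i by (simp add: v_def)
  qed (simp add: B_def A_def v_def)
  moreover have "v \<in> carrier_vec N" "v \<noteq> 0\<^sub>v N"
  proof -
    show "v \<in> carrier_vec N" by (simp add: v_def)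
    have "v $ 0 = 1" using N by (simp add: v_def)
    thus "v \<noteq> 0\<^sub>v N" using N by auto
  qed
  ultimately have "eigenvalue B x"
    using B by (auto simp: eigenvalue_def eigenvector_def)
  hence "poly (char_poly B) x = 0"
    using eigenvalue_root_char_poly[OF B] by simp
  moreover have "char_poly B = map_poly of_int (char_poly A)"
    unfolding B_def by (rule of_int_hom.char_poly_hom[OF A])
  ultimately have "poly (map_poly of_int (char_poly A)) x = 0" by simp
  moreover have "lead_coeff (char_poly A) = 1"
    using degree_monic_char_poly[OF A] by simp
  ultimately show ?thesis
    unfolding algebraic_int_altdef_ipoly x_def by blast
qed

text \<open>The witness is the constant term \<open>a0\<close> of an integer polynomial of least
  degree that vanishes at b = g(w); minimality makes it nonzero. Since a0 = - b r(b), divisibility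
  of b by p in Z[w] makes a0 / p an algebraic integer; being rational, it is an integer.\<close>

lemma finite_prime_divisors_root_of_unity:
  fixes w :: complex and g :: "int poly"
  assumes N: "N > 0" and w: "w ^ N = 1" and nz: "poly (map_poly of_int g) w \<noteq> 0"
  shows "\<exists>n::int. n \<noteq> 0 \<and> (\<forall>p::nat. p > 0 \<longrightarrow>
           (\<exists>s. poly (map_poly of_int g) w = of_nat p * poly (map_poly of_int s) w) \<longrightarrow> int p dvd n)"
proof -
  define b where "b = poly (map_poly of_int g) w"
  have "algebraic_int b"
    unfolding b_def by (rule algebraic_int_poly_root_of_unity[OF N w])
  then obtain q0 where q0: "poly (map_poly of_int q0) b = 0" "lead_coeff q0 = 1"
    unfolding algebraic_int_altdef_ipoly by blast
  hence "q0 \<noteq> 0" by auto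
  define q where "q = arg_min degree (\<lambda>q::int poly. q \<noteq> 0 \<and> poly (map_poly of_int q) b = 0)"
  have q: "q \<noteq> 0" "poly (map_poly of_int q) b = 0"
    using arg_min_natI[of "\<lambda>q. q \<noteq> 0 \<and> poly (map_poly of_int q) b = 0" q0 degree] q0(1) \<open>q0 \<noteq> 0\<close>
    unfolding q_def by auto
  have qmin: "degree q \<le> degree r" if "r \<noteq> 0" "poly (map_poly of_int r) b = 0" for r
    unfolding q_def by (rule arg_min_nat_le) (use that in auto)
  obtain a0 r where qr: "q = pCons a0 r" by (cases q)
  have eq: "of_int a0 + b * poly (map_poly of_int r) b = 0"
    using q(2) by (simp add: qr of_int_hom.map_poly_pCons_hom)
  have "a0 \<noteq> 0"
  proof
    assume "a0 = 0"
    hence "r \<noteq> 0" "poly (map_poly of_int r) b = 0" using q(1) eq nz by (auto simp: qr b_def)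
    from qmin[OF this] show False using \<open>r \<noteq> 0\<close> by (simp add: qr)
  qed
  moreover have "int p dvd a0" if p: "p > 0" and s: "b = of_nat p * poly (map_poly of_int s) w" for p s
  proof -
    define y where "y = poly (map_poly of_int (- (s * pcompose r g))) w"
    have y: "y = - (poly (map_poly of_int s) w * poly (map_poly of_int r) b)"
      unfolding y_def b_def
      by (simp add: of_int_hom.map_poly_pcompose poly_pcompose hom_distribs)
    have ay: "of_int a0 = of_nat p * y"
      using eq unfolding y by (simp add: s algebra_simps eq_neg_iff_add_eq_0)
    hence "y = of_int a0 / of_nat p" using p by simp
    hence "y \<in> \<rat>" by simp
    moreover have "algebraic_int y"
      unfolding y_def by (rule algebraic_int_poly_root_of_unity[OF N w])
    ultimately obtain m where "y = of_int m"
      using rational_algebraic_int_is_int Ints_cases by blast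
    hence "(of_int a0 :: complex) = of_int (int p * m)" using ay by simp
    hence "a0 = int p * m" by (simp only: of_int_eq_iff)
    thus ?thesis by simp
  qed
  ultimately show ?thesis unfolding b_def by blast
qed

text \<open>The inner binomial coefficients are multiples of p. The ring is general because both
  integers and integer polynomials are substituted.\<close>

lemma prime_dvd_power_add_diff:
  fixes x y :: "'a :: comm_ring_1"
  assumes p: "prime p"
  shows "of_nat p dvd (x + y) ^ p - x ^ p - y ^ p"
proof -
  have p0: "p > 0" using p prime_gt_0_nat by blast
  define f where "f k = of_nat (p choose k) * x ^ k * y ^ (p - k)" for k
  have "(x + y) ^ p = (\<Sum>k\<le>p. f k)"
    by (simp add: binomial_ring f_def)
  also have "{..p} = insert 0 (insert p {1..<p})" using p0 by auto
  also have "sum f \<dots> = y ^ p + x ^ p + (\<Sum>k\<in>{1..<p}. f k)"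
    using p0 by (simp add: f_def)
  finally have "(x + y) ^ p - x ^ p - y ^ p = (\<Sum>k\<in>{1..<p}. f k)" by simp
  also have "of_nat p dvd \<dots>"
  proof (rule dvd_sum)
    fix k assume k: "k \<in> {1..<p}"
    hence "p dvd (p choose k)"
      using p by (intro dvd_choose_prime) auto
    then obtain m where "p choose k = p * m" by blast
    thus "(of_nat p :: 'a) dvd f k" by (simp add: f_def mult.assoc)
  qed
  finally show ?thesis .
qed

lemma prime_dvd_power_diff_int:
  fixes a :: int
  assumes p: "prime p"
  shows "int p dvd a ^ p - a"
proof -
  have *: "int p dvd (int n) ^ p - int n" for n
  proof (induction n)
    case 0
    show ?case using prime_gt_0_nat[OF p] by (simp add: zero_power)
  next
    case (Suc n)
    have "int p dvd ((int n + 1) ^ p - int n ^ p - 1 ^ p) + (int n ^ p - int n)"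
      using prime_dvd_power_add_diff[OF p, of "int n" 1] Suc by (intro dvd_add) auto
    thus ?case by (simp add: algebra_simps)
  qed
  show ?thesis
  proof (cases "a \<ge> 0")
    case True
    thus ?thesis using *[of "nat a"] by simp
  next
    case False
    define n where "n = nat (- a)"
    have a: "a = - int n" using False by (simp add: n_def)
    \<comment> \<open>Expanding (n + (-n))^p = 0 compares (-n)^p with -(n^p) without treating p = 2
      separately.\<close>
    have "int p dvd (int n + - int n) ^ p - int n ^ p - (- int n) ^ p"
      using prime_dvd_power_add_diff[OF p, of "int n" "- int n"] by simp
    hence "int p dvd - (int n ^ p) - a ^ p"
      using prime_gt_0_nat[OF p] by (simp add: a power_0_left)
    hence "int p dvd - ((- (int n ^ p) - a ^ p) + (int n ^ p - int n))"
      using *[of n] by (subst dvd_minus_iff) (rule dvd_add)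
    thus ?thesis by (simp add: a add.commute)
  qed
qed

text \<open>Frobenius modulo p: the p-th power respects sums by
  \<open>prime_dvd_power_add_diff\<close> and fixes the integer coefficients by Fermat, so all it
  does is replace X by X^p.\<close>

lemma prime_dvd_pcompose_monom_diff:
  fixes g :: "int poly"
  assumes p: "prime p"
  shows "of_nat p dvd pcompose g (Polynomial.monom 1 p) - g ^ p"
proof (induction g)
  case 0
  thus ?case using prime_gt_0_nat[OF p] by (simp add: power_0_left)
next
  case (pCons a g)
  define X where "X = (Polynomial.monom 1 1 :: int poly)"
  have g: "pCons a g = [:a:] + X * g" by (simp add: X_def monom_altdef)
  have Xp: "X ^ p = Polynomial.monom 1 p" by (simp add: X_def monom_power)
  have 1: "of_nat p dvd ([:a:] + X * g) ^ p - [:a:] ^ p - (X * g) ^ p"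
    by (rule prime_dvd_power_add_diff[OF p])
  have "(of_nat p :: int poly) dvd [:a:] ^ p - [:a:]"
  proof -
    obtain m where "a ^ p - a = int p * m" using prime_dvd_power_diff_int[OF p, of a] by blast
    hence "[:a:] ^ p - [:a:] = of_nat p * [:m:]"
      by (simp add: poly_const_pow of_nat_poly)
    thus ?thesis by (metis dvd_triv_left)
  qed
  moreover have "of_nat p dvd X ^ p * (pcompose g (Polynomial.monom 1 p) - g ^ p)"
    using pCons by (intro dvd_mult) auto
  ultimately have "of_nat p dvd X ^ p * (pcompose g (Polynomial.monom 1 p) - g ^ p) - ([:a:] ^ p - [:a:])
      - (([:a:] + X * g) ^ p - [:a:] ^ p - (X * g) ^ p)"
    using 1 by (meson dvd_diff)
  also have "\<dots> = pcompose (pCons a g) (Polynomial.monom 1 p) - (pCons a g) ^ p"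
    unfolding g Xp by (simp add: pcompose_add pcompose_mult power_mult_distrib Xp algebra_simps)
       (simp add: X_def pcompose_pCons monom_altdef)
  finally show ?case .
qed

lemma poly_root_of_unity_prime_power:
  fixes w :: complex and g :: "int poly"
  assumes p: "prime p" and g: "poly (map_poly of_int g) w = 0"
  shows "\<exists>s. poly (map_poly of_int g) (w ^ p) = of_nat p * poly (map_poly of_int s) w"
proof -
  obtain s where "pcompose g (Polynomial.monom 1 p) - g ^ p = of_nat p * s"
    using prime_dvd_pcompose_monom_diff[OF p, of g] by blast
  hence "pcompose g (Polynomial.monom 1 p) = g ^ p + of_nat p * s" by (simp add: algebra_simps)
  hence "map_poly of_int (pcompose g (Polynomial.monom 1 p)) = (map_poly of_int (g ^ p + of_nat p * s) :: complex poly)"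
    by simp
  hence "poly (map_poly of_int (pcompose g (Polynomial.monom 1 p))) w = poly (map_poly of_int (g ^ p + of_nat p * s)) w"
    by simp
  hence "poly (map_poly of_int g) (w ^ p) = poly (map_poly of_int g) w ^ p + of_nat p * poly (map_poly of_int s) w"
    by (simp add: of_int_hom.map_poly_pcompose poly_pcompose hom_distribs poly_monom)
  thus ?thesis using g prime_gt_0_nat[OF p] by (auto simp: power_0_left)
qed

text \<open>Landau's argument for the irreducibility of cyclotomic polynomials: \<open>g(w^p)\<close> is divisible
  by \<open>p\<close> in \<open>\<int>[w]\<close>, while the finitely many nonzero values \<open>g(w^j)\<close> have only finitely many
  prime divisors, so \<open>g(w^p) = 0\<close> for all large \<open>p\<close>; and every residue class prime to \<open>N\<close>
  contains a product of large primes.\<close>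

lemma int_poly_root_of_unity_conjugate:
  fixes w :: complex and g :: "int poly"
  assumes N: "N > 0" and w: "w ^ N = 1" and g: "poly (map_poly of_int g) w = 0" and h: "coprime h N"
  shows "poly (map_poly of_int g) (w ^ h) = 0"
proof -
  let ?g = "poly (map_poly of_int g) :: complex \<Rightarrow> complex"
  \<comment> \<open>\<open>n j\<close> is a common multiple of all p that divide the nonzero value
    g(w^j) in Z[w]; where that value is zero, 1 serves as a dummy.\<close>
  have "\<exists>n::int. n \<noteq> 0 \<and> (?g (w ^ j) \<noteq> 0 \<longrightarrow> (\<forall>p::nat. p > 0 \<longrightarrow>
           (\<exists>s. ?g (w ^ j) = of_nat p * poly (map_poly of_int s) w) \<longrightarrow> int p dvd n))" for j
  proof (cases "?g (w ^ j) = 0")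
    case False
    have "map_poly of_int (pcompose g (Polynomial.monom 1 j)) = (pcompose (map_poly of_int g) (Polynomial.monom 1 j) :: complex poly)"
      by (simp add: of_int_hom.map_poly_pcompose)
    hence "poly (map_poly of_int (pcompose g (Polynomial.monom 1 j))) w = ?g (w ^ j)"
      by (simp add: poly_pcompose poly_monom)
    thus ?thesis using finite_prime_divisors_root_of_unity[OF N w, of "pcompose g (Polynomial.monom 1 j)"] False by auto
  qed (auto intro: exI[of _ 1])
  then obtain n where n: "\<And>j. n j \<noteq> (0::int)" 
    "\<And>j p s. ?g (w ^ j) \<noteq> 0 \<Longrightarrow> p > 0 \<Longrightarrow> 
        ?g (w ^ j) = of_nat p * poly (map_poly of_int s) w \<Longrightarrow> int p dvd n j"
    by metis
  \<comment> \<open>A prime beyond \<open>A\<close> divides none of the \<open>n j\<close> with j <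
    N, and every power of w equals one with exponent below N.\<close>
  define A where "A = nat (\<Sum>j<N. \<bar>n j\<bar>)"
  note wmod = root_of_unity_power_mod[OF w]
  have step: "?g (w ^ (j * p)) = 0" if p: "prime p" "p > A" and j: "?g (w ^ j) = 0" for j p
  proof (rule ccontr)
    assume nz: "?g (w ^ (j * p)) \<noteq> 0"
    obtain s where s: "?g ((w ^ j) ^ p) = of_nat p * poly (map_poly of_int s) (w ^ j)"
      using poly_root_of_unity_prime_power[OF p(1) j] by blast
    define i where "i = (j * p) mod N"
    have wi: "w ^ (j * p) = w ^ i" by (simp add: i_def wmod)
    have "poly (map_poly of_int (pcompose s (Polynomial.monom 1 j))) w = poly (map_poly of_int s) (w ^ j)"
      by (simp add: of_int_hom.map_poly_pcompose poly_pcompose poly_monom)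
    hence "?g (w ^ i) = of_nat p * poly (map_poly of_int (pcompose s (Polynomial.monom 1 j))) w"
      using s by (simp flip: wi add: power_mult)
    hence "int p dvd n i"
      using n(2)[of i p] nz p prime_gt_0_nat[OF p(1)] by (simp add: wi)
    hence "int p \<le> \<bar>n i\<bar>" using n(1)[of i] dvd_imp_le_int[of "n i" "int p"] by simp
    also have "\<bar>n i\<bar> \<le> (\<Sum>j<N. \<bar>n j\<bar>)"
      using N by (intro member_le_sum) (auto simp: i_def)
    also have "\<dots> = int A" by (simp add: A_def sum_nonneg)
    finally show False using p(2) by simp
  qed
  have all: "?g (w ^ (j * m)) = 0" if "m > 0" "\<And>p. prime p \<Longrightarrow> p dvd m \<Longrightarrow> p > A" "?g (w ^ j) = 0" for m j
    using that
  proof (induction m arbitrary: j rule: less_induct)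
    case (less m)
    show ?case
    proof (cases "m = 1")
      case False
      then obtain p where p: "prime p" "p dvd m" using prime_factor_nat by blast
      then obtain m' where m: "m = p * m'" by blast
      have "m' < m" "m' > 0" using less.prems(1) prime_gt_1_nat[OF p(1)] by (auto simp: m)
      moreover have "?g (w ^ (j * p)) = 0"
        using step[OF p(1) less.prems(2)[OF p] less.prems(3)] .
      ultimately have "?g (w ^ (j * p * m')) = 0"
        using less.prems(2) by (intro less.IH[of m' "j * p"]) (auto simp: m)
      thus ?thesis by (simp add: m mult.assoc)
    qed (use less in auto)
  qed
  \<comment> \<open>With this P no prime up to \<open>A\<close> divides h + N P: one that divides h
    divides neither N, which is coprime to h, nor P; one that does not divide h divides P and hence
    N P.\<close>
  define P where "P = (\<Prod>p | prime p \<and> p \<le> A \<and> \<not> p dvd h. p)"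
  have finP: "finite {p. prime p \<and> p \<le> A \<and> \<not> p dvd h}"
    by (rule finite_subset[of _ "{..A}"]) auto
  have P0: "P > 0" unfolding P_def by (intro prod_pos) (auto simp: prime_gt_0_nat)
  have big: "p > A" if p: "prime p" "p dvd h + N * P" for p
  proof (rule ccontr)
    assume "\<not> p > A"
    show False
    proof (cases "p dvd h")
      case True
      hence "p dvd N * P" using p(2) by (simp add: dvd_add_right_iff)
      moreover have "\<not> p dvd N" using True h p(1)
        by (metis coprime_common_divisor not_prime_unit)
      ultimately have "p dvd P" using p(1) by (simp add: prime_dvd_mult_iff)
      then obtain r where r: "prime r" "\<not> r dvd h" "p dvd r"
        using p(1) finP unfolding P_def by (auto simp: prime_dvd_prod_iff)
      hence "p = r" using p(1) primes_dvd_imp_eq by blast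
      thus False using r True by simp
    next
      case False
      hence "p dvd P" unfolding P_def using \<open>\<not> p > A\<close> p(1) finP
        by (intro dvd_prodI) auto
      hence "p dvd h" using p(2) by (simp add: dvd_add_left_iff)
      thus False using False by simp
    qed
  qed
  have "?g (w ^ (1 * (h + N * P))) = 0"
    by (rule all) (use N P0 big g in auto)
  moreover have "w ^ (h + N * P) = w ^ h" by (simp add: power_add power_mult w)
  ultimately show ?thesis by simp
qed

section \<open>Relations over a field disjoint from the real cyclotomic field\<close>

lemma subfield_Rats: "subfield_C \<rat>"
  by (auto simp: subfield_C_def)

lemma subfield_sum: "subfield_C K \<Longrightarrow> (\<And>i. i \<in> A \<Longrightarrow> f i \<in> K) \<Longrightarrow> sum f A \<in> K"
  by (induction A rule: infinite_finite_induct) (auto simp: subfield_C_def)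

lemma subfield_power: "subfield_C K \<Longrightarrow> x \<in> K \<Longrightarrow> x ^ n \<in> K"
  by (induction n) (auto simp: subfield_C_def)

lemma subfield_diff: "subfield_C K \<Longrightarrow> x \<in> K \<Longrightarrow> y \<in> K \<Longrightarrow> x - y \<in> K"
  by (metis subfield_C_def add_uminus_conv_diff)

lemma subfield_divide: "subfield_C K \<Longrightarrow> x \<in> K \<Longrightarrow> y \<in> K \<Longrightarrow> x / y \<in> K"
  by (metis subfield_C_def divide_inverse)

lemma Rats_subset_subfield:
  assumes "subfield_C K"
  shows "\<rat> \<subseteq> K"
proof
  fix x :: complex assume "x \<in> \<rat>"
  then obtain a b where x: "x = of_int a / of_int b" by (auto elim: Rats_cases')
  have nat: "of_nat n \<in> K" for n using assms by (induction n) (auto simp: subfield_C_def)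
  have "of_int n \<in> K" for n
    using nat[of "nat n"] nat[of "nat (-n)"] assms
    by (cases "n \<ge> 0") (auto simp: subfield_C_def of_nat_nat)
  thus "x \<in> K" unfolding x by (intro subfield_divide assms)
qed

text \<open>\<open>K\<close> is a set and not a type, so the polynomials over \<open>K\<close> are
  singled out among the complex ones, and closure under each operation has to be proved.\<close>

definition poly_over :: "complex set \<Rightarrow> complex poly set" where
  "poly_over K = {p. \<forall>i. poly.coeff p i \<in> K}"

context
  fixes K :: "complex set"
  assumes K: "subfield_C K"
begin

lemma poly_over_0: "0 \<in> poly_over K"
  using K by (auto simp: poly_over_def subfield_C_def)

lemma poly_over_add: "p \<in> poly_over K \<Longrightarrow> q \<in> poly_over K \<Longrightarrow> p + q \<in> poly_over K"
  using K by (auto simp: poly_over_def subfield_C_def)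

lemma poly_over_diff: "p \<in> poly_over K \<Longrightarrow> q \<in> poly_over K \<Longrightarrow> p - q \<in> poly_over K"
  using subfield_diff[OF K] by (auto simp: poly_over_def)

lemma poly_over_smult: "c \<in> K \<Longrightarrow> p \<in> poly_over K \<Longrightarrow> Polynomial.smult c p \<in> poly_over K"
  using K by (auto simp: poly_over_def subfield_C_def)

lemma poly_over_pCons_iff: "pCons a p \<in> poly_over K \<longleftrightarrow> a \<in> K \<and> p \<in> poly_over K"
  by (auto simp: poly_over_def coeff_pCons split: nat.splits)

lemma poly_over_mult: "p \<in> poly_over K \<Longrightarrow> q \<in> poly_over K \<Longrightarrow> p * q \<in> poly_over K"
  unfolding poly_over_def mem_Collect_eq Polynomial.coeff_mult
  by (intro allI subfield_sum[OF K]) (use K in \<open>simp add: subfield_C_def\<close>)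

lemma poly_over_sum: "(\<And>i. i \<in> A \<Longrightarrow> f i \<in> poly_over K) \<Longrightarrow> sum f A \<in> poly_over K"
  by (induction A rule: infinite_finite_induct) (auto intro: poly_over_0 poly_over_add)

lemma poly_over_pcompose: "p \<in> poly_over K \<Longrightarrow> q \<in> poly_over K \<Longrightarrow> pcompose p q \<in> poly_over K"
  by (induction p)
     (auto simp: pcompose_pCons poly_over_pCons_iff poly_over_0 intro!: poly_over_add poly_over_mult)

text \<open>Long division, one coefficient at a time: the old remainder is shifted by X, and
  subtracting \<open>c\<close> times the monic divisor clears its coefficient at
  \<open>degree m\<close>. No inverse is taken, so all coefficients stay in
  \<open>K\<close>.\<close>

lemma poly_over_division:
  assumes m: "m \<in> poly_over K" "lead_coeff m = 1"
  shows "t \<in> poly_over K \<Longrightarrow>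
    \<exists>q r. q \<in> poly_over K \<and> r \<in> poly_over K \<and> t = m * q + r \<and> (r = 0 \<or> degree r < degree m)"
proof (induction t)
  case 0
  thus ?case by (intro exI[of _ 0]) (auto simp: poly_over_0)
next
  case (pCons a t)
  then obtain q r where qr: "q \<in> poly_over K" "r \<in> poly_over K" "t = m * q + r" "r = 0 \<or> degree r < degree m"
    by (auto simp: poly_over_pCons_iff)
  define r1 where "r1 = pCons a r"
  have r1: "r1 \<in> poly_over K" using pCons.prems qr by (simp add: r1_def poly_over_pCons_iff)
  define c where "c = poly.coeff r1 (degree m)"
  have c: "c \<in> K" using r1 by (auto simp: c_def poly_over_def)
  define r2 where "r2 = r1 - Polynomial.smult c m"
  have "degree r1 \<le> degree m" using qr(4) by (auto simp: r1_def degree_pCons_le)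
  hence "degree r2 \<le> degree m" unfolding r2_def
    by (intro degree_diff_le) auto
  moreover have "poly.coeff r2 (degree m) = 0" using m by (simp add: r2_def c_def)
  ultimately have "r2 = 0 \<or> degree r2 < degree m"
    by (metis eq_zero_or_degree_less)
  moreover have "pCons a t = m * pCons c q + r2"
    unfolding r2_def r1_def qr(3) by (simp add: algebra_simps)
  moreover have "r2 \<in> poly_over K" "pCons c q \<in> poly_over K"
    using r1 c m qr by (auto simp: r2_def poly_over_pCons_iff intro!: poly_over_diff poly_over_smult)
  ultimately show ?case by blast
qed

text \<open>Over the complex numbers the polynomial splits into factors X - x, all with coefficients
  in \<open>K\<close>. Later the real cyclotomic field takes the place of \<open>K\<close>, and the
  polynomial is a minimal polynomial.\<close>

lemma monic_poly_over_of_roots: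
  assumes "lead_coeff p = 1" "\<And>x. poly p x = 0 \<Longrightarrow> x \<in> K"
  shows "p \<in> poly_over K"
  using assms
proof (induction "degree p" arbitrary: p)
  case 0
  then obtain c where c: "p = [:c:]" by (metis degree_eq_zeroE)
  thus ?case using 0 K by (auto simp: poly_over_pCons_iff poly_over_0 subfield_C_def)
next
  case (Suc n)
  have "\<not> constant (poly p)" using Suc.hyps(2) by (simp add: constant_degree)
  then obtain x where x: "poly p x = 0" using fundamental_theorem_of_algebra by blast
  then obtain q where q: "p = [:-x, 1:] * q" by (meson dvdE poly_eq_0_iff_dvd)
  have "q \<noteq> 0" using Suc.hyps(2) q by auto
  hence "degree p = Suc (degree q)" unfolding q by (subst degree_mult_eq) auto
  moreover have "lead_coeff q = 1" using Suc.prems(1) unfolding q by (simp only: lead_coeff_mult) simp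
  ultimately have "q \<in> poly_over K" using Suc.hyps(2) Suc.prems(2)
    by (intro Suc.hyps(1)) (auto simp: q)
  moreover have "x \<in> K" using Suc.prems(2) x by auto
  ultimately show ?case unfolding q using K
    by (intro poly_over_mult) (auto simp: poly_over_pCons_iff poly_over_0 subfield_C_def)
qed

end

lemma poly_over_mono: "p \<in> poly_over K \<Longrightarrow> K \<subseteq> L \<Longrightarrow> p \<in> poly_over L"
  by (auto simp: poly_over_def)

lemma rat_poly_root_of_unity_conjugate:
  fixes w :: complex
  assumes N: "N > 0" and w: "w ^ N = 1" and g: "g \<in> poly_over \<rat>" "poly g w = 0" and h: "coprime h N"
  shows "poly g (w ^ h) = 0"
proof -
  have "\<exists>d::int. d > 0 \<and> of_int d * poly.coeff g i \<in> \<int>" for i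
  proof -
    from g(1) have "poly.coeff g i \<in> \<rat>" by (simp add: poly_over_def)
    then obtain a b where "b > 0" "poly.coeff g i = of_int a / of_int b" by (auto elim: Rats_cases')
    thus ?thesis by (intro exI[of _ b]) auto
  qed
  then obtain d where d: "\<And>i. d i > (0::int)" "\<And>i. of_int (d i) * poly.coeff g i \<in> \<int>" by metis
  define D where "D = (\<Prod>i\<le>degree g. d i)"
  have D: "D > 0" unfolding D_def by (intro prod_pos) (auto simp: d)
  have int: "poly.coeff (Polynomial.smult (of_int D) g) i \<in> \<int>" for i
  proof (cases "i \<le> degree g")
    case True
    have "D = d i * (\<Prod>j\<in>{..degree g} - {i}. d j)"
      unfolding D_def using True by (subst prod.remove[of _ i]) auto
    hence "poly.coeff (Polynomial.smult (of_int D) g) i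
        = of_int (\<Prod>j\<in>{..degree g} - {i}. d j) * (of_int (d i) * poly.coeff g i)" by simp
    also have "\<dots> \<in> \<int>" by (intro Ints_mult d(2)) auto
    finally show ?thesis .
  qed (simp add: coeff_eq_0)
  then obtain G where G: "Polynomial.smult (of_int D) g = map_poly of_int G" using intpolyE by blast
  have "poly (map_poly of_int G) w = 0" unfolding G[symmetric] using g by simp
  hence "poly (map_poly of_int G) (w ^ h) = 0"
    by (rule int_poly_root_of_unity_conjugate[OF N w _ h])
  thus ?thesis unfolding G[symmetric] using D by simp
qed

section \<open>Cyclotomic fields and polynomials in the trace z + 1/z\<close>

lemma subfield_cyclotomic_field: "subfield_C (cyclotomic_field N)"
  unfolding subfield_C_def cyclotomic_field_def by auto

lemma zeta_n_in_cyclotomic_field: "zeta_n N \<in> cyclotomic_field N"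
  by (auto simp: cyclotomic_field_def)

lemma subfield_cyclotomic_plus: "subfield_C (cyclotomic_plus N)"
  using subfield_cyclotomic_field[of N] unfolding cyclotomic_plus_def subfield_C_def by auto

lemma zeta_n_power: "zeta_n N ^ j = cis (2 * pi * real j / real N)"
  by (simp add: zeta_n_def Complex.DeMoivre mult_ac)

lemma zeta_n_nonzero [simp]: "zeta_n N \<noteq> 0"
  by (simp add: zeta_n_def)

lemma zeta_n_power_self: "zeta_n N ^ N = 1"
  by (cases "N = 0") (simp_all add: zeta_n_power)

lemma root_of_unity_zeta_n:
  assumes "N > 0" "z ^ N = 1"
  obtains j where "z = zeta_n N ^ j"
proof -
  have "z \<in> (\<lambda>k. cis (2 * pi * real k / real N)) ` {..<N}"
    using Complex.bij_betw_roots_unity[OF assms(1)] assms(2) unfolding bij_betw_def by blast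
  thus ?thesis using that by (auto simp: zeta_n_power)
qed

lemma zeta_n_trace_in_cyclotomic_plus: "zeta_n N ^ j + inverse (zeta_n N ^ j) \<in> cyclotomic_plus N"
proof -
  have "zeta_n N ^ j + inverse (zeta_n N ^ j) \<in> cyclotomic_field N"
    using subfield_cyclotomic_field[of N] zeta_n_in_cyclotomic_field[of N]
          subfield_power[OF subfield_cyclotomic_field zeta_n_in_cyclotomic_field, of N j]
    by (auto simp: subfield_C_def)
  moreover have "zeta_n N ^ j + inverse (zeta_n N ^ j) \<in> \<real>"
    by (simp add: zeta_n_power complex_is_Real_iff)
  ultimately show ?thesis by (simp add: cyclotomic_plus_def)
qed

text \<open>These are the Dickson polynomials (Chebyshev polynomials up to scaling): S_0 = 2, S_1 =
  X, S_(n+2) = X S_(n+1) - S_n.\<close>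

lemma trace_power_poly:
  "\<exists>S \<in> poly_over \<rat>. \<forall>z. z \<noteq> 0 \<longrightarrow> poly S (z + inverse z) = z ^ n + inverse z ^ n"
proof (induction n rule: induct_nat_012)
  case 0
  show ?case by (intro bexI[of _ "[:2:]"])
    (auto simp: poly_over_pCons_iff[OF subfield_Rats] poly_over_0[OF subfield_Rats])
next
  case 1
  show ?case by (intro bexI[of _ "[:0,1:]"])
    (auto simp: poly_over_pCons_iff[OF subfield_Rats] poly_over_0[OF subfield_Rats])
next
  case (ge2 n)
  then obtain S T where S: "S \<in> poly_over \<rat>" "\<And>z. z \<noteq> 0 \<Longrightarrow> poly S (z + inverse z) = z ^ n + inverse z ^ n"
    and T: "T \<in> poly_over \<rat>" "\<And>z. z \<noteq> 0 \<Longrightarrow> poly T (z + inverse z) = z ^ Suc n + inverse z ^ Suc n"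
    by metis
  have "poly ([:0,1:] * T - S) (z + inverse z) = z ^ Suc (Suc n) + inverse z ^ Suc (Suc n)" if "z \<noteq> 0" for z
  proof -
    have "poly ([:0,1:] * T - S) (z + inverse z)
        = (z + inverse z) * (z ^ Suc n + inverse z ^ Suc n) - (z ^ n + inverse z ^ n)"
      using that by (simp add: S T algebra_simps)
    also have "\<dots> = z ^ Suc (Suc n) + inverse z ^ Suc (Suc n)"
      using that by (simp add: field_simps)
    finally show ?thesis .
  qed
  moreover have "[:0,1:] * T - S \<in> poly_over \<rat>"
    using S T by (intro poly_over_diff[OF subfield_Rats] poly_over_mult[OF subfield_Rats])
      (auto simp: poly_over_pCons_iff[OF subfield_Rats] poly_over_0[OF subfield_Rats])
  ultimately show ?case by blast
qed

text \<open>When G takes the same value at z and at 1/z, the polynomial S gives twice that value in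
  terms of the trace z + 1/z, which lies in the real subfield if z is a power of
  \<open>zeta_n N\<close>.\<close>

lemma trace_poly:
  assumes G: "G \<in> poly_over \<rat>"
  obtains S where "S \<in> poly_over \<rat>" "\<And>z. z \<noteq> 0 \<Longrightarrow> poly S (z + inverse z) = poly G z + poly G (inverse z)"
proof -
  obtain S where S: "\<And>n. S n \<in> poly_over \<rat>"
    "\<And>n z. z \<noteq> 0 \<Longrightarrow> poly (S n) (z + inverse z) = z ^ n + inverse z ^ n"
    using trace_power_poly by metis
  define T where "T = (\<Sum>i\<le>degree G. Polynomial.smult (poly.coeff G i) (S i))"
  have "T \<in> poly_over \<rat>" unfolding T_def using G S(1)
    by (intro poly_over_sum[OF subfield_Rats] poly_over_smult[OF subfield_Rats]) (auto simp: poly_over_def)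
  moreover have "poly T (z + inverse z) = poly G z + poly G (inverse z)" if "z \<noteq> 0" for z
    using that by (simp add: T_def poly_sum S poly_altdef[of G] algebra_simps sum.distrib)
  ultimately show ?thesis using that by blast
qed

text \<open>The numbers \<open>z\<close> and \<open>y\<close> of the proof are the roots of X^2 - w
  X + 1, whose product is 1.\<close>

lemma ex_add_inverse:
  fixes w :: complex
  obtains z where "z \<noteq> 0" "w = z + inverse z"
proof -
  define z where "z = (w + csqrt (w\<^sup>2 - 4)) / 2"
  define y where "y = (w - csqrt (w\<^sup>2 - 4)) / 2"
  have "csqrt (w\<^sup>2 - 4) * csqrt (w\<^sup>2 - 4) = w\<^sup>2 - 4"
    by (metis power2_csqrt power2_eq_square)
  hence "z * y = 1" unfolding z_def y_def by (simp add: algebra_simps power2_eq_square)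
  moreover have "w = z + y" by (simp add: z_def y_def field_simps)
  ultimately show ?thesis using that[of z] by (metis inverse_unique mult_zero_left zero_neq_one)
qed

text \<open>The minimal polynomial of \<open>\<zeta> + \<zeta>\<^sup>-\<^sup>1\<close> over \<open>K\<close> splits over \<open>\<rat>(\<zeta>)\<^sup>+\<close>, so its coefficients
  lie in the intersection of both fields, which is \<open>\<rat>\<close>.\<close>

lemma trace_conjugate:
  assumes K: "subfield_C K" and KN: "K \<inter> cyclotomic_plus N = \<rat>" and N: "N > 0" and h: "coprime h N"
    and T: "T \<in> poly_over K" "poly T (zeta_n N + inverse (zeta_n N)) = 0"
  shows "poly T (zeta_n N ^ h + inverse (zeta_n N ^ h)) = 0"
proof -
  define z where "z = zeta_n N"
  have z0: "z \<noteq> 0" and zN: "z ^ N = 1" by (simp_all add: z_def zeta_n_power_self)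
  have inv: "inverse (z ^ j) = (z ^ j) ^ (N - 1)" for j
  proof -
    have "(z ^ j) ^ (N - 1) * z ^ j = (z ^ j) ^ N"
      using N by (metis power_minus_mult)
    also have "\<dots> = 1" by (metis zN power_mult mult.commute power_one)
    finally show ?thesis using z0 by (simp add: field_simps)
  qed
  have QK: "\<rat> \<subseteq> K" by (rule Rats_subset_subfield[OF K])
  have XQ: "Polynomial.monom 1 n \<in> poly_over \<rat>" for n
    by (auto simp: poly_over_def)
  \<comment> \<open>The prescribed value is (x^N - 1)^2 / x^N, so the zeros of S are exactly the
    numbers x + 1/x with x^N = 1.\<close>
  obtain S where S: "S \<in> poly_over \<rat>"
    "\<And>x. x \<noteq> 0 \<Longrightarrow> poly S (x + inverse x) = (x ^ N - 1) + (inverse x ^ N - 1)"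
  proof -
    have "Polynomial.monom 1 N - 1 \<in> poly_over \<rat>"
      by (auto simp: poly_over_def)
    from trace_poly[OF this] show ?thesis using that by (auto simp: poly_monom)
  qed
  have Sz: "poly S (z + inverse z) = 0" by (simp add: S(2) z0 zN power_inverse)
  have S0: "S \<noteq> 0"
  proof
    assume "S = 0"
    \<comment> \<open>The test point is 2 + 1/2, where (2^N - 1)^2 / 2^N is not zero.\<close>
    hence "(2::complex) ^ N - 1 + (inverse 2 ^ N - 1) = 0" using S(2)[of 2] by simp
    hence "((2::complex) ^ N - 1)\<^sup>2 = 0" by (simp add: field_simps power2_eq_square)
    hence "(2::complex) ^ N = 1" by simp
    hence "norm ((2::complex) ^ N) = 1" by simp
    hence "(2::real) ^ N = 1" by (simp add: norm_power)
    thus False using N one_less_power[of "2::real" N] by simp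
  qed
  define P where "P = (\<lambda>m. m \<in> poly_over K \<and> m \<noteq> 0 \<and> poly m (z + inverse z) = 0)"
  have "P S" using S Sz S0 QK poly_over_mono by (auto simp: P_def)
  define m0 where "m0 = arg_min degree P"
  have m0: "P m0" unfolding m0_def by (rule arg_min_natI) fact
  have m0min: "degree m0 \<le> degree r" if "P r" for r
    unfolding m0_def by (rule arg_min_nat_le) fact
  define M where "M = Polynomial.smult (inverse (lead_coeff m0)) m0"
  have M: "M \<in> poly_over K" "lead_coeff M = 1" "poly M (z + inverse z) = 0" "degree M = degree m0"
    using m0 K by (auto simp: M_def P_def poly_over_def subfield_C_def)
  have Mdvd: "M dvd R" if R: "R \<in> poly_over K" "poly R (z + inverse z) = 0" for R
  proof -
    obtain q r where qr: "q \<in> poly_over K" "r \<in> poly_over K" "R = M * q + r" "r = 0 \<or> degree r < degree M"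
      using poly_over_division[OF K M(1,2) R(1)] by blast
    have "poly r (z + inverse z) = 0" using R(2) M(3) unfolding qr(3) by simp
    hence "r = 0" using m0min[of r] qr(2,4) M(4) by (cases "r = 0") (auto simp: P_def)
    thus ?thesis using qr by simp
  qed
  have "M dvd S" using Mdvd S(1) Sz QK poly_over_mono by blast
  have "M \<in> poly_over (cyclotomic_plus N)"
  proof (rule monic_poly_over_of_roots[OF subfield_cyclotomic_plus M(2)])
    fix w assume "poly M w = 0"
    hence w: "poly S w = 0" using \<open>M dvd S\<close> by (auto elim!: dvdE)
    obtain x where x: "x \<noteq> 0" "w = x + inverse x" by (rule ex_add_inverse)
    have "(x ^ N - 1) + (inverse x ^ N - 1) = 0" using w S(2)[OF x(1)] x(2) by simp
    hence "(x ^ N - 1)\<^sup>2 = 0" using x(1) by (simp add: field_simps power2_eq_square)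
    hence "x ^ N = 1" by simp
    then obtain j where "x = zeta_n N ^ j" using root_of_unity_zeta_n[OF N] by blast
    thus "w \<in> cyclotomic_plus N" using x zeta_n_trace_in_cyclotomic_plus by simp
  qed
  hence MQ: "M \<in> poly_over \<rat>" using M(1) KN unfolding poly_over_def by blast
  \<comment> \<open>Rewrites M(z + 1/z) as a rational polynomial in z itself, with 1/z = z^(N-1), so
    that conjugation of roots of unity applies.\<close>
  define g where "g = pcompose M (Polynomial.monom 1 1 + Polynomial.monom 1 (N - 1))"
  have "g \<in> poly_over \<rat>" unfolding g_def
    by (intro poly_over_pcompose[OF subfield_Rats] poly_over_add[OF subfield_Rats] MQ XQ)
  moreover have gj: "poly g (z ^ j) = poly M (z ^ j + inverse (z ^ j))" for j
    unfolding inv by (simp add: g_def poly_pcompose poly_monom)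
  have "poly g z = 0" using gj[of 1] M(3) by simp
  ultimately have "poly g (z ^ h) = 0"
    using rat_poly_root_of_unity_conjugate[OF N zN _ _ h] by blast
  hence "poly M (z ^ h + inverse (z ^ h)) = 0" by (simp add: gj)
  moreover have "M dvd T" using Mdvd T by (simp add: z_def)
  ultimately show ?thesis by (auto simp: z_def elim!: dvdE)
qed

text \<open>By symmetry the sum at zeta^j is half the value of one polynomial over \<open>K\<close>
  at the trace zeta^j + zeta^-j, for every j prime to N; \<open>trace_conjugate\<close> carries its
  vanishing from j = 1 to j = h.\<close>

lemma symmetric_relation_conjugate:
  assumes K: "subfield_C K" and KN: "K \<inter> cyclotomic_plus N = \<rat>" and N: "N > 0" and h: "coprime h N"
    and c: "\<And>i. i \<in> I \<Longrightarrow> c i \<in> K" and G: "\<And>i. i \<in> I \<Longrightarrow> G i \<in> poly_over \<rat>"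
    and sym: "\<And>i j. i \<in> I \<Longrightarrow> coprime j N \<Longrightarrow>
                poly (G i) (inverse (zeta_n N ^ j)) = poly (G i) (zeta_n N ^ j)"
    and rel: "(\<Sum>i\<in>I. c i * poly (G i) (zeta_n N)) = 0"
  shows "(\<Sum>i\<in>I. c i * poly (G i) (zeta_n N ^ h)) = 0"
proof -
  have "\<forall>i\<in>I. \<exists>S. S \<in> poly_over \<rat> \<and> (\<forall>z. z \<noteq> 0 \<longrightarrow> poly S (z + inverse z) = poly (G i) z + poly (G i) (inverse z))"
    using G trace_poly by metis
  then obtain S where S: "\<And>i. i \<in> I \<Longrightarrow> S i \<in> poly_over \<rat>"
    "\<And>i z. i \<in> I \<Longrightarrow> z \<noteq> 0 \<Longrightarrow> poly (S i) (z + inverse z) = poly (G i) z + poly (G i) (inverse z)"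
    by metis
  define T where "T = (\<Sum>i\<in>I. Polynomial.smult (c i) (S i))"
  have T: "T \<in> poly_over K" unfolding T_def
    using c S(1) Rats_subset_subfield[OF K] poly_over_mono
    by (intro poly_over_sum[OF K] poly_over_smult[OF K]) blast+
  have Tj: "poly T (zeta_n N ^ j + inverse (zeta_n N ^ j)) = 2 * (\<Sum>i\<in>I. c i * poly (G i) (zeta_n N ^ j))"
    if "coprime j N" for j
    unfolding T_def sum_distrib_left poly_sum by (intro sum.cong refl) (simp add: S sym that)
  have "poly T (zeta_n N + inverse (zeta_n N)) = 0"
    using Tj[of 1] rel by simp
  hence "poly T (zeta_n N ^ h + inverse (zeta_n N ^ h)) = 0"
    by (rule trace_conjugate[OF K KN N h T])
  thus ?thesis using Tj[OF h] by simp
qed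

text \<open>Multiplication by D(z) = z - 1/z, which also changes sign under inversion, gives a
  symmetric relation. The factor can be cancelled at zeta^h: otherwise zeta^(2h) = 1, and N would
  divide 2.\<close>

lemma antisymmetric_relation_conjugate:
  assumes K: "subfield_C K" and KN: "K \<inter> cyclotomic_plus N = \<rat>" and N: "N > 2" and h: "coprime h N"
    and c: "\<And>i. i \<in> I \<Longrightarrow> c i \<in> K" and G: "\<And>i. i \<in> I \<Longrightarrow> G i \<in> poly_over \<rat>"
    and sym: "\<And>i j. i \<in> I \<Longrightarrow> coprime j N \<Longrightarrow>
                poly (G i) (inverse (zeta_n N ^ j)) = - poly (G i) (zeta_n N ^ j)"
    and rel: "(\<Sum>i\<in>I. c i * poly (G i) (zeta_n N)) = 0"
  shows "(\<Sum>i\<in>I. c i * poly (G i) (zeta_n N ^ h)) = 0"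
proof -
  define z where "z = zeta_n N"
  have z0: "z \<noteq> 0" and zN: "z ^ N = 1" by (simp_all add: z_def zeta_n_power_self)
  define D where "D = (Polynomial.monom 1 1 - Polynomial.monom 1 (N - 1) :: complex poly)"
  have DQ: "D \<in> poly_over \<rat>"
    unfolding D_def by (intro poly_over_diff[OF subfield_Rats]) (auto simp: poly_over_def)
  have inv: "x ^ (N - 1) = inverse x" if "x ^ N = 1" for x :: complex
  proof -
    have "x ^ (N - 1) * x = 1"
      using N that by (metis power_minus_mult less_trans zero_less_numeral)
    thus ?thesis by (metis inverse_unique mult.commute)
  qed
  have zj: "(z ^ j) ^ N = 1" for j by (metis zN power_mult mult.commute power_one)
  have D: "poly D (z ^ j) = z ^ j - inverse (z ^ j)" for j
    using inv[OF zj[of j]] by (simp add: D_def poly_monom)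
  have D': "poly D (inverse (z ^ j)) = - poly D (z ^ j)" for j
  proof -
    have "inverse (z ^ j) ^ N = 1" using zj[of j] by (simp add: power_inverse)
    hence "poly D (inverse (z ^ j)) = inverse (z ^ j) - z ^ j"
      using inv[of "inverse (z ^ j)"] by (simp add: D_def poly_monom)
    thus ?thesis by (simp add: D)
  qed
  have "(\<Sum>i\<in>I. c i * poly (D * G i) (zeta_n N ^ h)) = 0"
  proof (rule symmetric_relation_conjugate[OF K KN _ h c])
    show "D * G i \<in> poly_over \<rat>" if "i \<in> I" for i
      by (intro poly_over_mult[OF subfield_Rats] DQ G that)
    show "poly (D * G i) (inverse (zeta_n N ^ j)) = poly (D * G i) (zeta_n N ^ j)"
      if "i \<in> I" "coprime j N" for i j
      using sym[OF that] D'[of j] by (simp add: z_def)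
    have "(\<Sum>i\<in>I. c i * poly (D * G i) (zeta_n N)) = poly D (zeta_n N) * (\<Sum>i\<in>I. c i * poly (G i) (zeta_n N))"
      by (simp add: sum_distrib_left mult_ac)
    thus "(\<Sum>i\<in>I. c i * poly (D * G i) (zeta_n N)) = 0" using rel by simp
  qed (use N in auto)
  moreover have "(\<Sum>i\<in>I. c i * poly (D * G i) (zeta_n N ^ h)) = poly D (z ^ h) * (\<Sum>i\<in>I. c i * poly (G i) (zeta_n N ^ h))"
    by (simp add: sum_distrib_left mult_ac z_def)
  moreover have "poly D (z ^ h) \<noteq> 0"
  proof
    assume "poly D (z ^ h) = 0"
    hence "z ^ h * z ^ h = 1" using D[of h] z0 by (simp add: field_simps)
    hence "zeta_n N ^ (2 * h) = 1" by (simp only: z_def mult_2 power_add)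
    hence "cis (2 * pi * real (2 * h) / real N) = 1" by (simp only: zeta_n_power)
    then obtain m :: int where "2 * pi * real (2 * h) / real N = of_int (2 * m) * pi"
      unfolding cis_conv_exp exp_eq_1 by auto
    hence "real (2 * h) = real_of_int m * real N" using N by (simp add: field_simps)
    hence "int (2 * h) = m * int N" by (metis of_int_eq_iff of_int_mult of_int_of_nat_eq)
    hence "int N dvd int (2 * h)" by simp
    hence "N dvd 2 * h" by (simp only: int_dvd_int_iff)
    hence "N dvd 2" using h by (metis coprime_commute coprime_dvd_mult_left_iff)
    thus False using N by (auto dest: dvd_imp_le)
  qed
  ultimately show ?thesis by simp
qed

section \<open>Hurwitz zeta values and the cotangent\<close>

text \<open>The derivatives of \<open>\<pi> cot(\<pi>z) = \<pi>\<i> (1 - 2u)\<close> as polynomials in \<open>u = 1 / (1 - exp(2\<pi>\<i>z))\<close>, up to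
  a power of \<open>2\<pi>\<i>\<close>; the recursion comes from \<open>u' = 2\<pi>\<i> (u\<^sup>2 - u)\<close>.\<close>

primrec cot_deriv_poly :: "nat \<Rightarrow> complex poly" where
  "cot_deriv_poly 0 = [:0, 1:]"
| "cot_deriv_poly (Suc n) = [:0, -1, 1:] * pderiv (cot_deriv_poly n)"

text \<open>Logarithmic derivative of Gamma(z) Gamma(1 - z) = pi / sin(pi z).\<close>

lemma Digamma_reflection_complex:
  fixes z :: complex
  assumes z: "z \<notin> \<int>"
  shows "Digamma (1 - z) - Digamma z = of_real pi * cot (of_real pi * z)"
proof -
  let ?p = "of_real pi :: complex"
  have z1: "1 - z \<notin> \<int>" using z by (metis Ints_1 Ints_diff diff_diff_eq2 add_diff_cancel_left')
  have nz: "z \<notin> \<int>\<^sub>\<le>\<^sub>0" "1 - z \<notin> \<int>\<^sub>\<le>\<^sub>0" using z z1 nonpos_Ints_Int by blast+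
  have G0: "Gamma z * Gamma (1 - z) \<noteq> 0" using nz by (simp add: Gamma_eq_zero_iff)
  have s0: "sin (?p * z) \<noteq> 0"
    using G0 unfolding Gamma_reflection_complex by auto
  have "((\<lambda>z. Gamma z * Gamma (1 - z)) has_field_derivative
      Gamma z * Gamma (1 - z) * (Digamma z - Digamma (1 - z))) (at z)"
    using nz by (auto intro!: derivative_eq_intros simp: algebra_simps)
  moreover have "((\<lambda>z. ?p / sin (?p * z)) has_field_derivative
      - (?p / sin (?p * z)) * (?p * cot (?p * z))) (at z)"
    using s0 by (auto intro!: derivative_eq_intros simp: cot_def field_simps)
  ultimately have "Gamma z * Gamma (1 - z) * (Digamma z - Digamma (1 - z))
      = - (?p / sin (?p * z)) * (?p * cot (?p * z))"
    unfolding Gamma_reflection_complex by (rule DERIV_unique)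
  hence "(?p / sin (?p * z)) * (Digamma (1 - z) - Digamma z) = (?p / sin (?p * z)) * (?p * cot (?p * z))"
    unfolding Gamma_reflection_complex by (simp add: algebra_simps)
  thus ?thesis using s0 by simp
qed

lemma exp_2pi_i_eq_1_iff: "exp (2 * of_real pi * \<i> * z) = 1 \<longleftrightarrow> z \<in> \<int>"
proof
  assume "exp (2 * of_real pi * \<i> * z) = 1"
  then obtain n :: int where "Re (2 * of_real pi * \<i> * z) = 0" "Im (2 * of_real pi * \<i> * z) = of_int (2 * n) * pi"
    unfolding exp_eq_1 by blast
  hence "z = of_int n" by (auto simp: complex_eq_iff)
  thus "z \<in> \<int>" by simp
next
  assume "z \<in> \<int>"
  then obtain n where z: "z = of_int n" by (auto elim: Ints_cases)
  show "exp (2 * of_real pi * \<i> * z) = 1"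
    unfolding exp_eq_1 by (auto simp: z)
qed

text \<open>Each differentiation of the digamma reflection raises the order by one. At order 0 the
  formula carries an extra constant pi i, which disappears with the first derivative; hence n >
  0.\<close>

lemma Polygamma_reflection_complex:
  fixes z :: complex
  assumes "z \<notin> \<int>" "n > 0"
  shows "(-1) ^ n * Polygamma n (1 - z) - Polygamma n z
      = - ((2 * of_real pi * \<i>) ^ Suc n) * poly (cot_deriv_poly n) (1 / (1 - exp (2 * of_real pi * \<i> * z)))"
proof -
  define c where "c = 2 * of_real pi * \<i>"
  define u where "u = (\<lambda>z. 1 / (1 - exp (c * z)))"
  have e1: "exp (c * z) \<noteq> 1" if "z \<notin> \<int>" for z
    using that exp_2pi_i_eq_1_iff[of z] by (simp add: c_def)
  have u': "(u has_field_derivative c * ((u z)\<^sup>2 - u z)) (at z)" if "z \<notin> \<int>" for z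
  proof -
    have e: "1 - exp (c * z) \<noteq> 0" using e1[OF that] by simp
    have "((\<lambda>z. inverse (1 - exp (c * z))) has_field_derivative
        - (inverse (1 - exp (c * z)) * (- (exp (c * z) * c)) * inverse (1 - exp (c * z)))) (at z)"
      by (rule DERIV_inverse') (use e in \<open>auto intro!: derivative_eq_intros\<close>)
    moreover have "- (inverse (1 - E) * (- (E * c)) * inverse (1 - E)) = c * ((1 / (1 - E))\<^sup>2 - 1 / (1 - E))"
      if "1 - E \<noteq> 0" for E
      using that by (simp add: divide_simps power2_eq_square)
    ultimately show ?thesis using e by (simp add: u_def inverse_eq_divide)
  qed
  define R where "R = (\<lambda>n z. (-1) ^ n * Polygamma n (1 - z) - Polygamma n z :: complex)"
  have R': "(R n has_field_derivative R (Suc n) z) (at z)" if "z \<notin> \<int>" for n z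
  proof -
    have z1: "1 - z \<notin> \<int>" using that by (metis Ints_1 Ints_diff diff_diff_eq2 add_diff_cancel_left')
    have nz: "z \<notin> \<int>\<^sub>\<le>\<^sub>0" "1 - z \<notin> \<int>\<^sub>\<le>\<^sub>0" using that z1 nonpos_Ints_Int by blast+
    show ?thesis unfolding R_def using nz
      by (auto intro!: derivative_eq_intros)
  qed
  \<comment> \<open>The formulas hold off the integers only; since that domain is open, equal
    functions on it have equal derivatives.\<close>
  have op: "open (- \<int> :: complex set)" by (simp add: open_Compl)
  have R0: "R 0 z = of_real pi * \<i> - c * poly (cot_deriv_poly 0) (u z)" if "z \<notin> \<int>" for z
  proof -
    define E where "E = exp (\<i> * (of_real pi * z))"
    have E0: "E \<noteq> 0" by (simp add: E_def)
    have E2: "exp (c * z) = E * E" by (simp add: E_def c_def flip: exp_add) (simp add: algebra_simps)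
    have E1: "E * E \<noteq> 1" using e1[OF that] by (simp add: E2)
    have inv: "exp (- (\<i> * (of_real pi * z))) = 1 / E" by (simp add: E_def exp_minus field_simps)
    have "cot (of_real pi * z) = \<i> * (E * E + 1) / (E * E - 1)"
      unfolding cot_def cos_exp_eq sin_exp_eq inv using E0 E1
      by (simp add: E_def[symmetric] divide_simps)
    also have "\<dots> = \<i> * (1 - 2 * u z)"
      using E1 by (simp add: u_def E2 divide_simps) (simp add: algebra_simps)
    finally have cot: "cot (of_real pi * z) = \<i> * (1 - 2 * u z)" .
    have "R 0 z = of_real pi * (\<i> * (1 - 2 * u z))"
      unfolding R_def cot[symmetric] Digamma_reflection_complex[OF that, symmetric] by simp
    thus ?thesis by (simp add: c_def algebra_simps)
  qed
  have main: "R (Suc n) z = - (c ^ Suc (Suc n)) * poly (cot_deriv_poly (Suc n)) (u z)" if "z \<notin> \<int>" for n z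
    using that
  proof (induction n arbitrary: z)
    case 0
    have "((\<lambda>z. of_real pi * \<i> - c * poly (cot_deriv_poly 0) (u z)) has_field_derivative
        - (c ^ 2) * poly (cot_deriv_poly (Suc 0)) (u z)) (at z)"
      by (auto intro!: derivative_eq_intros u' 0 simp: pderiv_pCons algebra_simps power2_eq_square)
    hence "(R 0 has_field_derivative - (c ^ 2) * poly (cot_deriv_poly (Suc 0)) (u z)) (at z)"
      using 0 R0 by (rule_tac has_field_derivative_transform_within_open[OF _ op]) auto
    thus ?case using DERIV_unique[OF R'[OF 0, of 0]] by (simp add: numeral_2_eq_2)
  next
    case (Suc n)
    have "((\<lambda>z. - (c ^ Suc (Suc n)) * poly (cot_deriv_poly (Suc n)) (u z)) has_field_derivative
        - (c ^ Suc (Suc n)) * (poly (pderiv (cot_deriv_poly (Suc n))) (u z) * (c * ((u z)\<^sup>2 - u z)))) (at z)"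
      by (intro DERIV_cmult DERIV_chain2[OF poly_DERIV] u' Suc.prems)
    hence "(R (Suc n) has_field_derivative
        - (c ^ Suc (Suc n)) * (poly (pderiv (cot_deriv_poly (Suc n))) (u z) * (c * ((u z)\<^sup>2 - u z)))) (at z)"
      using Suc by (rule_tac has_field_derivative_transform_within_open[OF _ op]) auto
    hence "R (Suc (Suc n)) z
        = - (c ^ Suc (Suc n)) * (poly (pderiv (cot_deriv_poly (Suc n))) (u z) * (c * ((u z)\<^sup>2 - u z)))"
      using DERIV_unique[OF R'[OF Suc.prems, of "Suc n"]] by blast
    also have "\<dots> = - (c ^ Suc (Suc (Suc n))) * poly (cot_deriv_poly (Suc (Suc n))) (u z)"
      by (subst (2) cot_deriv_poly.simps(2)) (simp add: algebra_simps power2_eq_square del: cot_deriv_poly.simps)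
    finally show ?case .
  qed
  obtain m where "n = Suc m" using assms(2) by (cases n) auto
  thus ?thesis using main[OF assms(1), of m] by (simp add: R_def c_def u_def del: cot_deriv_poly.simps)
qed

section \<open>From polygamma functions to values at roots of unity\<close>

lemma hurwitz_zeta_sums:
  assumes "x > 0" "k > 1"
  shows "(\<lambda>n. 1 / (real n + x) ^ k) sums hurwitz_zeta k x"
proof -
  have "summable (\<lambda>n. inverse ((x + real n) ^ k))"
    using Polygamma_converges'[of x k] assms by simp
  hence "summable (\<lambda>n. 1 / (real n + x) ^ k)" by (simp add: inverse_eq_divide add.commute)
  thus ?thesis unfolding hurwitz_zeta_def by (rule summable_sums)
qed

lemma Polygamma_hurwitz_zeta:
  assumes "x > 0" "n > 0"
  shows "Polygamma n x = (-1) ^ Suc n * fact n * hurwitz_zeta (Suc n) x"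
proof -
  have "(\<lambda>k. inverse ((x + of_nat k) ^ Suc n)) sums ((-1) ^ Suc n * Polygamma n x / fact n)"
    using assms by (intro Polygamma_LIMSEQ) auto
  hence "(\<lambda>k. 1 / (real k + x) ^ Suc n) sums ((-1) ^ Suc n * Polygamma n x / fact n)"
    by (simp add: inverse_eq_divide add.commute)
  moreover have "(\<lambda>k. 1 / (real k + x) ^ Suc n) sums hurwitz_zeta (Suc n) x"
    using assms by (intro hurwitz_zeta_sums) auto
  ultimately have "hurwitz_zeta (Suc n) x = (-1) ^ Suc n * Polygamma n x / fact n"
    by (rule sums_unique2[symmetric])
  moreover have "(-1::real) ^ Suc n * (-1) ^ Suc n = 1" by (simp flip: power_mult_distrib)
  ultimately show ?thesis by (simp add: mult.assoc[symmetric])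
qed

text \<open>Up to sign and factorial both zeta values are polygamma values of order k - 1. The
  prefactor on the right depends on k alone, and for rational x the remaining factor is a rational
  expression in a root of unity.\<close>

lemma hurwitz_zeta_reflection:
  assumes x: "0 < x" "x < 1" and k: "k > 1"
  shows "complex_of_real (hurwitz_zeta k x + (-1) ^ k * hurwitz_zeta k (1 - x))
     = (- 2 * of_real pi * \<i>) ^ k / fact (k - 1)
         * poly (cot_deriv_poly (k - 1)) (1 / (1 - cis (2 * pi * x)))"
proof -
  obtain n where k: "k = Suc n" "n > 0" using k by (cases k) auto
  have "complex_of_real x \<notin> \<int>"
  proof
    assume "complex_of_real x \<in> \<int>"
    then obtain m where "complex_of_real x = of_int m" by (auto elim: Ints_cases)
    hence "x = of_int m" by (metis of_real_eq_iff of_real_of_int_eq)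
    thus False using x by auto
  qed
  from Polygamma_reflection_complex[OF this k(2)]
  have "complex_of_real ((-1) ^ n * Polygamma n (1 - x) - Polygamma n x) =
     - ((2 * of_real pi * \<i>) ^ k) * poly (cot_deriv_poly n) (1 / (1 - exp (2 * of_real pi * \<i> * of_real x)))"
    using x by (simp add: k flip: Polygamma_of_real del: cot_deriv_poly.simps)
  also have "exp (2 * of_real pi * \<i> * of_real x) = cis (2 * pi * x)"
    by (simp add: cis_conv_exp mult_ac)
  also have "(-1) ^ n * Polygamma n (1 - x) - Polygamma n x =
      - ((-1) ^ k * fact n * (hurwitz_zeta k x + (-1) ^ k * hurwitz_zeta k (1 - x)))"
    using x k(2) by (simp add: Polygamma_hurwitz_zeta k(1) algebra_simps flip: power_mult_distrib)
  finally have *: "(-1) ^ k * fact n * complex_of_real (hurwitz_zeta k x + (-1) ^ k * hurwitz_zeta k (1 - x))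
      = (2 * of_real pi * \<i>) ^ k * poly (cot_deriv_poly n) (1 / (1 - cis (2 * pi * x)))"
    by simp
  have "(-1) ^ k * ((-1) ^ k * fact n * complex_of_real (hurwitz_zeta k x + (-1) ^ k * hurwitz_zeta k (1 - x)))
      = (- 2 * of_real pi * \<i>) ^ k * poly (cot_deriv_poly n) (1 / (1 - cis (2 * pi * x)))"
    unfolding * by (simp only: mult.assoc[symmetric] power_mult_distrib[symmetric]) simp
  moreover have "(-1::complex) ^ k * (-1) ^ k = 1" by (simp flip: power_mult_distrib)
  ultimately show ?thesis 
    by (simp add: k mult.assoc[symmetric] divide_simps del: cot_deriv_poly.simps) (simp add: mult_ac)
qed

text \<open>The factor u^2 - u of the recursion is invariant under u -> 1 - u, and each derivative
  changes the sign. For n = 0 the claim fails by the constant in 1 - u.\<close>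

lemma cot_deriv_poly_reflect:
  assumes "n > 0"
  shows "pcompose (cot_deriv_poly n) [:1, -1:] = Polynomial.smult ((-1) ^ Suc n) (cot_deriv_poly n)"
  using assms
proof (induction n)
  case (Suc n)
  show ?case
  proof (cases "n = 0")
    case True
    show ?thesis by (simp add: True pcompose_pCons pderiv_pCons)
  next
    case False
    define p where "p = cot_deriv_poly n"
    have "pcompose p [:1, -1:] = Polynomial.smult ((-1) ^ Suc n) p" using Suc False by (simp add: p_def)
    hence "pderiv (pcompose p [:1, -1:]) = Polynomial.smult ((-1) ^ Suc n) (pderiv p)"
      by (simp add: pderiv_smult pderiv_minus)
    hence "pcompose (pderiv p) [:1, -1:] = Polynomial.smult ((-1) ^ n) (pderiv p)"
      by (simp add: pderiv_pcompose pderiv_pCons)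
    hence "pcompose ([:0, -1, 1:] * pderiv p) [:1, -1:] = [:0, -1, 1:] * Polynomial.smult ((-1) ^ n) (pderiv p)"
      unfolding pcompose_mult by (simp add: pcompose_pCons)
    thus ?thesis by (simp add: p_def)
  qed
qed simp

text \<open>Inverting w replaces u = 1/(1 - w) by 1 - u. With n = k - 1 the sign is (-1)^k, which
  later decides between the symmetric and the antisymmetric transfer of relations.\<close>

lemma cot_deriv_poly_inverse:
  assumes "n > 0" "w \<noteq> 0" "w \<noteq> 1"
  shows "poly (cot_deriv_poly n) (1 / (1 - inverse w)) = (-1) ^ Suc n * poly (cot_deriv_poly n) (1 / (1 - w))"
proof -
  have "1 / (1 - inverse w) = poly [:1, -1:] (1 / (1 - w))" using assms by (simp add: divide_simps) (simp add: algebra_simps)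
  hence "poly (cot_deriv_poly n) (1 / (1 - inverse w)) = poly (pcompose (cot_deriv_poly n) [:1, -1:]) (1 / (1 - w))"
    by (simp only: poly_pcompose)
  thus ?thesis using cot_deriv_poly_reflect[OF assms(1)] by simp
qed

lemma cot_deriv_poly_rat: "cot_deriv_poly n \<in> poly_over \<rat>"
proof (induction n)
  case (Suc n)
  hence "pderiv (cot_deriv_poly n) \<in> poly_over \<rat>" by (auto simp: poly_over_def coeff_pderiv)
  thus ?case unfolding cot_deriv_poly.simps
    by (intro poly_over_mult[OF subfield_Rats])
       (auto simp: poly_over_pCons_iff[OF subfield_Rats] poly_over_0[OF subfield_Rats])
qed (auto simp: poly_over_pCons_iff[OF subfield_Rats] poly_over_0[OF subfield_Rats])

text \<open>Turns 1/(1 - w) into a rational polynomial in w: multiplied by 1 - w, the sum of the i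
  w^i collapses to the full geometric sum, which vanishes, minus q.\<close>

lemma inverse_one_minus_root_of_unity:
  fixes w :: complex
  assumes q: "q > 0" and w: "w ^ q = 1" "w \<noteq> 1"
  shows "1 / (1 - w) = - (\<Sum>i<q. of_nat i * w ^ i) / of_nat q"
proof -
  have "(1 - w) * (\<Sum>i<n. of_nat i * w ^ i) = (\<Sum>i<n. w ^ i) - 1 - (of_nat n - 1) * w ^ n" if "n > 0" for n
    using that
  proof (induction n rule: nat_induct_non_zero)
    case (Suc n)
    thus ?case by (simp add: algebra_simps)
  qed simp
  from this[OF q] have "(1 - w) * (\<Sum>i<q. of_nat i * w ^ i) = (\<Sum>i<q. w ^ i) - of_nat q"
    using w by simp
  also have "(\<Sum>i<q. w ^ i) = 0" using w by (simp add: geometric_sum)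
  finally show ?thesis using w q by (simp add: divide_simps) (simp add: algebra_simps)
qed

text \<open>A single polynomial serves all nontrivial q-th roots of unity, so the values for
  different a differ only in the power at which it is evaluated.\<close>

lemma cot_deriv_poly_root_of_unity:
  assumes q: "q > 0"
  obtains G where "G \<in> poly_over \<rat>"
    "\<And>w. w ^ q = 1 \<Longrightarrow> w \<noteq> 1 \<Longrightarrow> poly G w = poly (cot_deriv_poly n) (1 / (1 - w))"
proof -
  define U where "U = (\<Sum>i<q. Polynomial.monom (- (of_nat i / of_nat q)) i :: complex poly)"
  have "U \<in> poly_over \<rat>"
    unfolding U_def by (intro poly_over_sum[OF subfield_Rats]) (auto simp: poly_over_def)
  hence "pcompose (cot_deriv_poly n) U \<in> poly_over \<rat>"
    by (intro poly_over_pcompose[OF subfield_Rats] cot_deriv_poly_rat)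
  moreover have "poly U w = 1 / (1 - w)" if "w ^ q = 1" "w \<noteq> 1" for w
    unfolding inverse_one_minus_root_of_unity[OF q that] U_def
    by (simp add: poly_sum poly_monom sum_divide_distrib sum_negf)
  ultimately show ?thesis using that[of "pcompose (cot_deriv_poly n) U"] by (simp add: poly_pcompose)
qed

section \<open>Size and distribution of Hurwitz zeta values\<close>

lemma hurwitz_zeta_ge:
  assumes "x > 0" "k > 1"
  shows "hurwitz_zeta k x \<ge> 1 / x ^ k"
proof -
  have "(\<Sum>n\<in>{0}. 1 / (real n + x) ^ k) \<le> hurwitz_zeta k x"
    using hurwitz_zeta_sums[OF assms] assms(1)
    by (subst hurwitz_zeta_def, intro sum_le_suminf) (auto simp: sums_iff)
  thus ?thesis by simp
qed

lemma hurwitz_zeta_pos: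
  assumes "x > 0" "k > 1"
  shows "hurwitz_zeta k x > 0"
  using hurwitz_zeta_ge[OF assms] assms(1) by (meson less_le_trans zero_less_divide_1_iff zero_less_power)

text \<open>After the first term 1, the terms are bounded by 1/((n+1)(n+2)), which telescopes to
  1.\<close>

lemma hurwitz_zeta_1_le_2:
  assumes k: "k > 1"
  shows "hurwitz_zeta k 1 \<le> 2"
proof -
  let ?f = "\<lambda>n. 1 / (real n + 1) ^ k"
  have f: "?f sums hurwitz_zeta k 1" using hurwitz_zeta_sums[of 1 k] k by simp
  have "(\<lambda>n. 1 / real (Suc n)) \<longlonglongrightarrow> 0" by (rule LIMSEQ_Suc[OF lim_1_over_n])
  from telescope_sums'[OF this]
  have g: "(\<lambda>n. 1 / real (Suc n) - 1 / real (Suc (Suc n))) sums 1" by simp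
  have "(\<lambda>n. ?f (Suc n)) sums (hurwitz_zeta k 1 - ?f 0)"
    using f by (subst sums_Suc_iff) simp
  moreover have "?f (Suc n) \<le> 1 / real (Suc n) - 1 / real (Suc (Suc n))" for n
  proof -
    have "?f (Suc n) \<le> 1 / (real n + 2) ^ 2"
      using k by (intro divide_left_mono) (auto intro!: power_increasing simp: add.commute)
    also have "\<dots> \<le> 1 / ((real n + 1) * (real n + 2))"
      by (intro divide_left_mono) (auto simp: power2_eq_square intro!: mult_right_mono)
    also have "\<dots> = 1 / real (Suc n) - 1 / real (Suc (Suc n))"
      by (simp add: divide_simps) (simp add: algebra_simps)
    finally show ?thesis .
  qed
  ultimately have "hurwitz_zeta k 1 - ?f 0 \<le> 1" using g by (rule_tac sums_le)
  thus ?thesis by simp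
qed

text \<open>Distribution relation: the series of zeta(k) is cut into blocks of q consecutive
  integers n q + b with 1 <= b <= q, and q^k is moved into the terms.\<close>

lemma sum_hurwitz_zeta:
  assumes k: "k > 1" and q: "q > 0"
  shows "(\<Sum>b\<in>{0<..q}. hurwitz_zeta k (real b / real q)) = real q ^ k * hurwitz_zeta k 1"
proof -
  have "(\<lambda>n. \<Sum>m\<in>{n*q..<n*q+q}. 1 / (real m + 1) ^ k) sums hurwitz_zeta k 1"
    by (rule sums_group[OF hurwitz_zeta_sums]) (use assms in auto)
  hence "(\<lambda>n. real q ^ k * (\<Sum>m\<in>{n*q..<n*q+q}. 1 / (real m + 1) ^ k)) sums (real q ^ k * hurwitz_zeta k 1)"
    by (rule sums_mult)
  also have "(\<lambda>n. real q ^ k * (\<Sum>m\<in>{n*q..<n*q+q}. 1 / (real m + 1) ^ k))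
      = (\<lambda>n. \<Sum>b\<in>{0<..q}. 1 / (real n + real b / real q) ^ k)"
  proof
    fix n
    have "(\<Sum>m\<in>{n*q..<n*q+q}. 1 / (real m + 1) ^ k) = (\<Sum>b\<in>{0<..q}. 1 / (real (n * q + b)) ^ k)"
      by (rule sum.reindex_bij_witness[of _ "\<lambda>b. n * q + b - 1" "\<lambda>m. m + 1 - n * q"])
         (auto simp: of_nat_diff add.commute)
    hence "real q ^ k * (\<Sum>m\<in>{n*q..<n*q+q}. 1 / (real m + 1) ^ k)
        = (\<Sum>b\<in>{0<..q}. real q ^ k * (1 / (real (n * q + b)) ^ k))"
      by (simp add: sum_distrib_left)
    also have "\<dots> = (\<Sum>b\<in>{0<..q}. 1 / (real n + real b / real q) ^ k)"
    proof (intro sum.cong refl)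
      fix b
      have "real n + real b / real q = real (n * q + b) / real q" using q by (simp add: field_simps)
      thus "real q ^ k * (1 / (real (n * q + b)) ^ k) = 1 / (real n + real b / real q) ^ k"
        by (simp add: power_divide)
    qed
    finally show "real q ^ k * (\<Sum>m\<in>{n*q..<n*q+q}. 1 / (real m + 1) ^ k)
      = (\<Sum>b\<in>{0<..q}. 1 / (real n + real b / real q) ^ k)" .
  qed
  finally have "(\<lambda>n. \<Sum>b\<in>{0<..q}. 1 / (real n + real b / real q) ^ k) sums (real q ^ k * hurwitz_zeta k 1)" .
  moreover have "(\<lambda>n. \<Sum>b\<in>{0<..q}. 1 / (real n + real b / real q) ^ k) sums
      (\<Sum>b\<in>{0<..q}. hurwitz_zeta k (real b / real q))"
    by (intro sums_sum hurwitz_zeta_sums) (use assms in auto)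
  ultimately show ?thesis using sums_unique2 by blast
qed

text \<open>Sorting b by gcd(b, q) turns the distribution relation into: the S(d) over all d
  dividing q add up to q^k zeta(k). Induction solves this for S(q). The factor is the Jordan totient
  of order k; only its rationality is recorded.\<close>

lemma sum_totatives_hurwitz_zeta:
  assumes k: "k > 1"
  shows "q > 0 \<Longrightarrow> \<exists>r\<in>\<rat>. (\<Sum>a\<in>totatives q. hurwitz_zeta k (real a / real q)) = r * hurwitz_zeta k 1"
proof (induction q rule: less_induct)
  case (less q)
  define S where "S = (\<lambda>d. \<Sum>a\<in>totatives d. hurwitz_zeta k (real a / real d))"
  define D where "D = {d. d dvd q}"
  have finD: "finite D" using less.prems by (simp add: D_def)
  have "(\<Sum>b\<in>{0<..q}. hurwitz_zeta k (real b / real q))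
      = (\<Sum>d\<in>D. \<Sum>b\<in>{b\<in>{0<..q}. gcd b q = d}. hurwitz_zeta k (real b / real q))"
    by (rule sum.group[symmetric]) (auto simp: finD, auto simp: D_def)
  also have "\<dots> = (\<Sum>d\<in>D. S (q div d))"
  proof (intro sum.cong refl)
    fix d assume d: "d \<in> D"
    hence "d > 0" "d dvd q" using less.prems by (auto simp: D_def intro: Nat.gr0I)
    hence bij: "bij_betw (\<lambda>k. k * d) (totatives (q div d)) {k\<in>{0<..q}. gcd k q = d}"
      using less.prems by (intro bij_betw_totatives_gcd_eq)
    have "(\<Sum>b\<in>{b\<in>{0<..q}. gcd b q = d}. hurwitz_zeta k (real b / real q))
        = (\<Sum>a\<in>totatives (q div d). hurwitz_zeta k (real (a * d) / real q))"
      by (rule sum.reindex_bij_betw[OF bij, symmetric])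
    also have "\<dots> = S (q div d)"
      unfolding S_def using \<open>d > 0\<close> \<open>d dvd q\<close>
      by (intro sum.cong refl arg_cong[of _ _ "hurwitz_zeta k"]) (simp add: real_of_nat_div field_simps)
    finally show "(\<Sum>b\<in>{b\<in>{0<..q}. gcd b q = d}. hurwitz_zeta k (real b / real q)) = S (q div d)" .
  qed
  also have "\<dots> = (\<Sum>d\<in>D. S d)"
    by (rule sum.reindex_bij_witness[of _ "\<lambda>d. q div d" "\<lambda>d. q div d"])
       (use less.prems in \<open>auto simp: D_def\<close>)
  also have "\<dots> = S q + (\<Sum>d\<in>D - {q}. S d)"
    by (rule sum.remove) (auto simp: finD, auto simp: D_def)
  finally have eq: "S q = real q ^ k * hurwitz_zeta k 1 - (\<Sum>d\<in>D - {q}. S d)"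
    using sum_hurwitz_zeta[OF k less.prems] by simp
  have "\<forall>d\<in>D - {q}. \<exists>r\<in>\<rat>. S d = r * hurwitz_zeta k 1"
  proof
    fix d assume "d \<in> D - {q}"
    hence "d < q" "d > 0" using less.prems
      by (auto simp: D_def dest: dvd_imp_le intro: Nat.gr0I le_neq_implies_less)
    thus "\<exists>r\<in>\<rat>. S d = r * hurwitz_zeta k 1" unfolding S_def by (rule less.IH)
  qed
  then obtain r where r: "\<And>d. d \<in> D - {q} \<Longrightarrow> r d \<in> \<rat> \<and> S d = r d * hurwitz_zeta k 1" by metis
  have "S q = (real q ^ k - (\<Sum>d\<in>D - {q}. r d)) * hurwitz_zeta k 1"
    unfolding eq using r by (simp add: algebra_simps sum_distrib_left)
  moreover have "real q ^ k - (\<Sum>d\<in>D - {q}. r d) \<in> \<rat>"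
    using r by (intro Rats_diff Rats_power Rats_sum) auto
  ultimately show ?case unfolding S_def by blast
qed

section \<open>Linear relations between Hurwitz zeta values\<close>

text \<open>The index set of the generators in \<open>Vplus\<close>. For q > 2 it contains exactly
  one of a and q - a for each residue a prime to q, because q/2 is never prime to q.\<close>

definition half_totatives :: "nat \<Rightarrow> nat set" where
  "half_totatives q = {a. 1 \<le> a \<and> real a < real q / 2 \<and> coprime a q}"

definition hurwitz_pair :: "nat \<Rightarrow> nat \<Rightarrow> nat \<Rightarrow> complex" where
  "hurwitz_pair k q a = complex_of_real (hurwitz_zeta k (real a / real q)
                   + (-1) ^ k * hurwitz_zeta k (1 - real a / real q))"

section \<open>Reflection and multiplication on the residues prime to q\<close>

lemma totatives_reflect:
  assumes "q > 1" "a \<in> totatives q"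
  shows "q - a \<in> totatives q"
proof -
  have "a < q" "coprime a q" using assms totatives_less[of a q] by (auto simp: in_totatives_iff)
  moreover from this have "gcd (q - a) q = 1" by (subst gcd_diff2_nat) auto
  hence "coprime (q - a) q" by (simp only: coprime_iff_gcd_eq_1)
  ultimately show ?thesis by (simp add: in_totatives_iff)
qed

lemma totatives_mult_mod:
  assumes "q > 1" "coprime h q" "coprime a q"
  shows "a * h mod q \<in> totatives q"
proof -
  have "coprime (a * h mod q) q" using assms by simp
  moreover from this have "a * h mod q \<noteq> 0" using assms(1) by (metis coprime_0_left_iff nat_dvd_1_iff_1 less_irrefl)
  ultimately show ?thesis using assms(1) by (auto simp: in_totatives_iff less_imp_le)
qed

lemma totatives_reflect_mult_mod:
  assumes q: "q > 1" and h: "coprime h q" and a: "a \<in> totatives q"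
  shows "(q - a) * h mod q = q - a * h mod q"
proof -
  have "a * h mod q \<in> totatives q"
    using a by (intro totatives_mult_mod[OF q h]) (simp add: in_totatives_iff)
  hence lt: "a * h mod q < q" "a * h mod q > 0" using totatives_less[OF _ q] by (auto simp: in_totatives_iff)
  have "(q - a) * h + a * h = q * h" using totatives_le[OF a] by (simp flip: add_mult_distrib)
  moreover have "((q - a * h mod q) + a * h) mod q = ((q - a * h mod q) + a * h mod q) mod q"
    by (simp add: mod_simps)
  ultimately have "[(q - a) * h + a * h = (q - a * h mod q) + a * h] (mod q)"
    using lt by (simp add: cong_def)
  hence "[(q - a) * h = q - a * h mod q] (mod q)" by (simp only: cong_add_rcancel_nat)
  thus ?thesis using lt by (simp add: cong_def)
qed

lemma bij_betw_totatives_mult_mod: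
  assumes q: "q > 1" and h: "coprime h q"
  shows "bij_betw (\<lambda>a. a * h mod q) (totatives q) (totatives q)"
proof -
  have "inj_on (\<lambda>a. a * h mod q) (totatives q)"
  proof (rule inj_onI)
    fix a b assume ab: "a \<in> totatives q" "b \<in> totatives q" "a * h mod q = b * h mod q"
    hence "[a * h = b * h] (mod q)" by (simp add: cong_def)
    hence "[a = b] (mod q)" using h by (simp add: cong_mult_rcancel_nat)
    thus "a = b" using ab totatives_less[OF _ q] by (auto simp: cong_def)
  qed
  moreover have "(\<lambda>a. a * h mod q) ` totatives q \<subseteq> totatives q"
    using totatives_mult_mod[OF q h] by (auto simp: in_totatives_iff)
  ultimately show ?thesis
    by (simp add: bij_betw_def endo_inj_surj)
qed

lemma half_totatives_subset: "q > 2 \<Longrightarrow> half_totatives q \<subseteq> totatives q"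
  by (auto simp: half_totatives_def in_totatives_iff)

lemma finite_half_totatives [simp]: "finite (half_totatives q)"
  by (rule finite_subset[of _ "{..q}"]) (auto simp: half_totatives_def)

lemma totative_not_half:
  assumes "q > 2" "a \<in> totatives q"
  shows "2 * a \<noteq> q"
proof
  assume "2 * a = q"
  hence "a dvd q" by auto
  moreover have "coprime a q" using assms by (simp add: in_totatives_iff)
  ultimately have "a dvd 1" by (metis coprime_common_divisor dvd_refl)
  thus False using \<open>2 * a = q\<close> assms(1) by simp
qed

lemma totatives_reflect_half_iff:
  assumes q: "q > 2" and a: "a \<in> totatives q"
  shows "q - a \<in> half_totatives q \<longleftrightarrow> a \<notin> half_totatives q"
proof -
  have "a < q" "coprime a q" "coprime (q - a) q" "a > 0"
    using a q totatives_less[of a q] totatives_reflect[of q a] by (auto simp: in_totatives_iff)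
  thus ?thesis using totative_not_half[OF q a] by (auto simp: half_totatives_def of_nat_diff)
qed

lemma sum_totatives_split:
  fixes g :: "nat \<Rightarrow> 'a :: comm_monoid_add"
  assumes q: "q > 2"
  shows "(\<Sum>a\<in>totatives q. g a) = (\<Sum>a\<in>half_totatives q. g a + g (q - a))"
proof -
  let ?A = "half_totatives q"
  have "(\<Sum>a\<in>totatives q. g a) = (\<Sum>a\<in>totatives q - ?A. g a) + (\<Sum>a\<in>?A. g a)"
    by (rule sum.subset_diff[OF half_totatives_subset[OF q]]) simp
  also have "(\<Sum>a\<in>totatives q - ?A. g a) = (\<Sum>a\<in>?A. g (q - a))"
  proof (rule sum.reindex_bij_witness[of _ "\<lambda>a. q - a" "\<lambda>a. q - a"])
    fix a assume a: "a \<in> ?A"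
    hence t: "a \<in> totatives q" using half_totatives_subset[OF q] by auto
    have "q - a \<in> totatives q" using totatives_reflect[OF _ t] q by simp
    moreover have "q - (q - a) = a" using totatives_le[OF t] by simp
    ultimately show "q - a \<in> totatives q - ?A" "q - (q - a) = a"
      using totatives_reflect_half_iff[OF q t] totatives_reflect_half_iff[OF q, of "q - a"] a by auto
  next
    fix a assume a: "a \<in> totatives q - ?A"
    thus "q - (q - a) = a" using totatives_le[of a q] by simp
    show "q - a \<in> ?A" using a totatives_reflect_half_iff[OF q, of a] by simp
    show "g (q - (q - a)) = g a" using a totatives_le[of a q] by simp
  qed
  finally show ?thesis by (simp add: sum.distrib add.commute)
qed

lemma card_half_totatives:
  assumes "q > 2"
  shows "2 * card (half_totatives q) = totient q"
  using sum_totatives_split[OF assms, of "\<lambda>_. 1 :: nat"] by (simp add: totient_def)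

text \<open>The matrix of values \<open>\<zeta>(k, ah/q)\<close> is strictly diagonally dominant after permuting its rows:
  the entry \<open>\<zeta>(k, 1/q) \<ge> q^k\<close> exceeds the sum of the others, since all together sum up to less than
  \<open>q^k \<zeta>(k) \<le> 2 q^k\<close>.\<close>

lemma hurwitz_pair_kernel:
  fixes b :: "nat \<Rightarrow> complex"
  assumes k: "k > 1" and q: "q > 2"
    and sym: "\<And>a. a \<in> totatives q \<Longrightarrow> b (q - a) = (-1) ^ k * b a"
    and rel: "\<And>h. coprime h q \<Longrightarrow> (\<Sum>a\<in>totatives q. b a * hurwitz_pair k q (a * h mod q)) = 0"
    and a: "a \<in> totatives q"
  shows "b a = 0"
proof -
  define T where "T = totatives q"
  have finT: "finite T" by (simp add: T_def)
  define Z where "Z = (\<lambda>r. hurwitz_zeta k (real r / real q))"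
  have Tq: "a < q" if "a \<in> T" for a using that q totatives_less[of a q] by (simp add: T_def)
  have T0: "a > 0" if "a \<in> T" for a using that by (simp add: T_def in_totatives_iff)
  have Zpos: "Z r > 0" if "r > 0" for r
    unfolding Z_def using that q k by (intro hurwitz_zeta_pos) auto
  have pair: "hurwitz_pair k q r = of_real (Z r) + (-1) ^ k * of_real (Z (q - r))" if "r \<in> T" for r
  proof -
    have "1 - real r / real q = real (q - r) / real q"
      using Tq[OF that] by (simp add: of_nat_diff field_simps)
    thus ?thesis by (simp add: hurwitz_pair_def Z_def)
  qed
  \<comment> \<open>The symmetry of \<open>b\<close> lets the reflected half of each pair be
    reindexed by a -> q - a, so the sum over pairs is twice a sum of single values zeta(k,
    r/q).\<close>
  have sumZ: "(\<Sum>a\<in>T. b a * of_real (Z (a * h mod q))) = 0" if h: "coprime h q" for h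
  proof -
    have reflect: "(q - a) * h mod q = q - a * h mod q" if "a \<in> T" for a
      using that h q by (intro totatives_reflect_mult_mod) (auto simp: T_def)
    have mem: "a * h mod q \<in> T" if "a \<in> T" for a unfolding T_def
      using that h q by (intro totatives_mult_mod) (auto simp: T_def in_totatives_iff)
    have "(\<Sum>a\<in>T. b a * ((-1) ^ k * of_real (Z (q - a * h mod q))))
        = (\<Sum>a\<in>T. b (q - a) * of_real (Z ((q - a) * h mod q)))"
      by (intro sum.cong refl) (subst reflect, assumption, simp add: sym[folded T_def] mult_ac)
    also have "\<dots> = (\<Sum>a\<in>T. b a * of_real (Z (a * h mod q)))"
      by (rule sum.reindex_bij_witness[of _ "\<lambda>a. q - a" "\<lambda>a. q - a"])
         (use q totatives_reflect[of q] in \<open>auto simp: T_def totatives_le\<close>)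
    finally have "(\<Sum>a\<in>T. b a * hurwitz_pair k q (a * h mod q)) = 2 * (\<Sum>a\<in>T. b a * of_real (Z (a * h mod q)))"
      using mem by (simp add: pair distrib_left sum.distrib)
    thus ?thesis using rel[OF h] by (simp add: T_def)
  qed
  have "T \<noteq> {}" using q by (simp add: T_def)
  define M where "M = Max ((\<lambda>a. norm (b a)) ` T)"
  have "M \<in> (\<lambda>a. norm (b a)) ` T" unfolding M_def using finT \<open>T \<noteq> {}\<close> by (intro Max_in) auto
  then obtain a0 where a0: "a0 \<in> T" "norm (b a0) = M" by auto
  have M: "norm (b a) \<le> M" if "a \<in> T" for a unfolding M_def using that finT by (intro Max_ge) auto
  have "coprime a0 q" using a0 by (simp add: T_def in_totatives_iff)
  \<comment> \<open>The row belonging to the inverse of \<open>a0\<close> puts the large entry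
    zeta(k, 1/q) on the coefficient of maximal absolute value.\<close>
  then obtain h where h: "[a0 * h = 1] (mod q)"
    by (auto dest: cong_solve_coprime_nat)
  hence "[h * a0 = Suc 0] (mod q)" by (simp add: mult.commute)
  hence hq: "coprime h q" unfolding coprime_iff_invertible_nat by blast
  have a0h: "a0 * h mod q = 1" using h q by (simp add: cong_def)
  have bij: "bij_betw (\<lambda>a. a * h mod q) T T"
    unfolding T_def using q hq by (intro bij_betw_totatives_mult_mod) auto
  have mem: "a * h mod q \<in> T" if "a \<in> T" for a using bij that by (auto simp: bij_betw_def)
  define Y where "Y = (\<Sum>a\<in>T - {a0}. Z (a * h mod q))"
  have "b a0 * of_real (Z 1) + (\<Sum>a\<in>T - {a0}. b a * of_real (Z (a * h mod q))) = 0"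
    using sumZ[OF hq] sum.remove[OF finT a0(1), of "\<lambda>a. b a * of_real (Z (a * h mod q))"] a0h by simp
  hence "b a0 * of_real (Z 1) = - (\<Sum>a\<in>T - {a0}. b a * of_real (Z (a * h mod q)))"
    by (simp add: eq_neg_iff_add_eq_0)
  hence "norm (b a0 * of_real (Z 1)) = norm (\<Sum>a\<in>T - {a0}. b a * of_real (Z (a * h mod q)))" by simp
  also have "\<dots> \<le> (\<Sum>a\<in>T - {a0}. norm (b a * of_real (Z (a * h mod q))))" by (rule norm_sum)
  also have "\<dots> \<le> (\<Sum>a\<in>T - {a0}. M * Z (a * h mod q))"
  proof (rule sum_mono)
    fix a assume "a \<in> T - {a0}"
    hence "a \<in> T" by simp
    hence "Z (a * h mod q) > 0" using mem T0 Zpos by blast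
    thus "norm (b a * of_real (Z (a * h mod q))) \<le> M * Z (a * h mod q)"
      using M[OF \<open>a \<in> T\<close>] by (simp add: norm_mult mult_right_mono)
  qed
  also have "\<dots> = M * Y" by (simp add: Y_def sum_distrib_left)
  finally have le: "M * Z 1 \<le> M * Y" using a0(2) Zpos[of 1] by (simp add: norm_mult)
  have "Z 1 + Y = (\<Sum>a\<in>T. Z (a * h mod q))"
    unfolding Y_def using sum.remove[OF finT a0(1), of "\<lambda>a. Z (a * h mod q)"] a0h by simp
  also have "\<dots> = (\<Sum>a\<in>T. Z a)" by (rule sum.reindex_bij_betw[OF bij])
  \<comment> \<open>Strict because a = q occurs on the right and is not prime to q; this is the
    source of the strict inequality \<open>Y < Z 1\<close>.\<close>
  also have "\<dots> < (\<Sum>a\<in>{0<..q}. Z a)"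
  proof (rule sum_strict_mono2)
    show "T \<subseteq> {0<..q}" by (simp add: T_def totatives_subset)
    show "q \<in> {0<..q} - T" using q Tq[of q] by auto
  qed (use Zpos q in \<open>auto intro: less_imp_le\<close>)
  also have "\<dots> = real q ^ k * hurwitz_zeta k 1"
    unfolding Z_def using k q by (intro sum_hurwitz_zeta) auto
  also have "\<dots> \<le> real q ^ k * 2"
    using hurwitz_zeta_1_le_2[OF k] by (intro mult_left_mono) auto
  also have "\<dots> \<le> 2 * Z 1"
    using hurwitz_zeta_ge[of "real 1 / real q" k] k q by (simp add: Z_def power_divide)
  finally have "Y < Z 1" by simp
  have "M \<ge> 0" using a0(2) by (metis norm_ge_zero)
  have "M = 0"
  proof (rule ccontr)
    assume "M \<noteq> 0"
    hence "M > 0" using \<open>M \<ge> 0\<close> by simp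
    hence "Z 1 \<le> Y" using le by simp
    thus False using \<open>Y < Z 1\<close> by simp
  qed
  thus ?thesis using M[of a] a by (simp add: T_def)
qed

section \<open>Relations between the zeta values of several moduli\<close>

lemma zeta_n_power_eq_1_iff:
  assumes "q > 0"
  shows "zeta_n q ^ j = 1 \<longleftrightarrow> q dvd j"
proof
  assume "q dvd j"
  thus "zeta_n q ^ j = 1" by (auto simp: power_mult zeta_n_power_self elim!: dvdE)
next
  assume "zeta_n q ^ j = 1"
  hence "cis (2 * pi * real j / real q) = 1" by (simp only: zeta_n_power)
  then obtain m :: int where "2 * pi * real j / real q = of_int (2 * m) * pi"
    unfolding cis_conv_exp exp_eq_1 by auto
  hence "real j = real_of_int m * real q" using assms by (simp add: field_simps)
  hence "int j = m * int q" by (metis of_int_eq_iff of_int_mult of_int_of_nat_eq)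
  hence "int q dvd int j" by simp
  thus "q dvd j" by (simp only: int_dvd_int_iff)
qed

lemma zeta_n_power_cong:
  assumes "[i = j] (mod q)"
  shows "zeta_n q ^ i = zeta_n q ^ j"
  using assms root_of_unity_power_mod[OF zeta_n_power_self] by (metis cong_def)

lemma zeta_n_divisor:
  assumes "q dvd N" "N > 0"
  shows "zeta_n N ^ (N div q) = zeta_n q"
proof -
  obtain m where m: "N = q * m" using assms(1) by blast
  thus ?thesis using assms(2) by (simp add: zeta_n_power) (simp add: zeta_n_def)
qed

text \<open>Once the common factor \<open>\<kappa>\<close> is divided out, every value is a rational
  polynomial in the single root of unity \<open>zeta_n N\<close>. Under inversion these values are
  multiplied by (-1)^k, so the parity of k selects the symmetric or the antisymmetric
  transfer.\<close>

lemma hurwitz_pair_relation_conjugate: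
  assumes K: "subfield_C K" and k: "k > 1" and finQ: "finite Q" and Q2: "\<And>q. q \<in> Q \<Longrightarrow> q > 2"
    and QN: "\<And>q. q \<in> Q \<Longrightarrow> q dvd N" and N: "N > 2"
    and KN: "K \<inter> cyclotomic_plus N = \<rat>"
    and c: "\<And>q a. q \<in> Q \<Longrightarrow> a \<in> half_totatives q \<Longrightarrow> c q a \<in> K"
    and rel: "(\<Sum>q\<in>Q. \<Sum>a\<in>half_totatives q. c q a * hurwitz_pair k q a) = 0"
    and h: "coprime h N"
  shows "(\<Sum>q\<in>Q. \<Sum>a\<in>half_totatives q. c q a * hurwitz_pair k q (a * h mod q)) = 0"
proof -
  define n where "n = k - 1"
  have n: "n > 0" "k = Suc n" using k by (auto simp: n_def)
  define \<kappa> where "\<kappa> = (- 2 * of_real pi * \<i>) ^ k / fact (k - 1)"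
  have \<kappa>: "\<kappa> \<noteq> 0" by (simp add: \<kappa>_def)
  define E where "E = (\<lambda>w. poly (cot_deriv_poly n) (1 / (1 - w)))"
  have pair: "hurwitz_pair k q a = \<kappa> * E (zeta_n q ^ a)" if "0 < a" "a < q" for q a
    unfolding hurwitz_pair_def \<kappa>_def E_def n_def zeta_n_power
    using hurwitz_zeta_reflection[of "real a / real q" k] that k by simp
  have "\<forall>q\<in>Q. \<exists>G. G \<in> poly_over \<rat> \<and> (\<forall>w. w ^ q = 1 \<longrightarrow> w \<noteq> 1 \<longrightarrow> poly G w = E w)"
  proof
    fix q assume "q \<in> Q"
    hence "q > 0" using Q2 by fastforce
    thus "\<exists>G. G \<in> poly_over \<rat> \<and> (\<forall>w. w ^ q = 1 \<longrightarrow> w \<noteq> 1 \<longrightarrow> poly G w = E w)"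
      using cot_deriv_poly_root_of_unity[of q n] unfolding E_def by metis
  qed
  then obtain G where G: "\<And>q. q \<in> Q \<Longrightarrow> G q \<in> poly_over \<rat>"
    "\<And>q w. q \<in> Q \<Longrightarrow> w ^ q = 1 \<Longrightarrow> w \<noteq> 1 \<Longrightarrow> poly (G q) w = E w" by metis
  define I where "I = Sigma Q half_totatives"
  have finI: "finite I" unfolding I_def using finQ by (intro finite_SigmaI) auto
  \<comment> \<open>zeta_q^a is the power of zeta_N with exponent a N / q, so the variable of
    \<open>G q\<close> is replaced by that monomial.\<close>
  define P where "P = (\<lambda>(q, a). pcompose (G q) (Polynomial.monom 1 (a * (N div q))))"
  define d where "d = (\<lambda>(q, a). c q a)"
  have unit: "coprime (a * j) q" "q > 2" "coprime a q" "0 < a" "a < q"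
    if "q \<in> Q" "a \<in> half_totatives q" "coprime j N" for q a j
  proof -
    show "q > 2" by (rule Q2[OF that(1)])
    show a: "coprime a q" using that by (simp add: half_totatives_def)
    show "0 < a" "a < q" using that(2) by (auto simp: half_totatives_def)
    have "coprime j q" using that(3) QN[OF that(1)] by (meson coprime_divisors dvd_refl)
    thus "coprime (a * j) q" using a by simp
  qed
  have ne1: "zeta_n q ^ m \<noteq> 1" if "q > 2" "coprime m q" for q m
  proof
    assume "zeta_n q ^ m = 1"
    hence "q dvd m" using that by (simp add: zeta_n_power_eq_1_iff)
    hence "q dvd 1" using that(2) by (metis coprime_common_divisor dvd_refl)
    thus False using that(1) by simp
  qed
  have pow1: "(zeta_n q ^ m) ^ q = 1" for q m
    by (metis zeta_n_power_self power_mult mult.commute power_one)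
  have Pval: "poly (P (q, a)) (zeta_n N ^ j) = E (zeta_n q ^ (a * j))"
    and Pinv: "poly (P (q, a)) (inverse (zeta_n N ^ j)) = E (inverse (zeta_n q ^ (a * j)))"
    if "q \<in> Q" "a \<in> half_totatives q" "coprime j N" for q a j
  proof -
    have *: "(zeta_n N ^ j) ^ (a * (N div q)) = zeta_n q ^ (a * j)"
    proof -
      have "(zeta_n N ^ j) ^ (a * (N div q)) = (zeta_n N ^ (N div q)) ^ (a * j)"
        by (simp add: power_mult[symmetric] mult_ac)
      thus ?thesis using zeta_n_divisor[OF QN[OF that(1)]] N by simp
    qed
    note u = unit[OF that]
    have ne: "zeta_n q ^ (a * j) \<noteq> 1" using u by (intro ne1) auto
    show "poly (P (q, a)) (zeta_n N ^ j) = E (zeta_n q ^ (a * j))"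
      using G(2)[OF that(1) pow1 ne] by (simp add: P_def poly_pcompose poly_monom *)
    have "inverse (zeta_n q ^ (a * j)) ^ q = 1" using pow1[of q "a * j"] by (simp add: power_inverse)
    moreover have "inverse (zeta_n q ^ (a * j)) \<noteq> 1" using ne by simp
    moreover have "inverse (zeta_n N ^ j) ^ (a * (N div q)) = inverse (zeta_n q ^ (a * j))"
      using * by (simp only: power_inverse)
    ultimately show "poly (P (q, a)) (inverse (zeta_n N ^ j)) = E (inverse (zeta_n q ^ (a * j)))"
      using G(2)[OF that(1), of "inverse (zeta_n q ^ (a * j))"]
      by (simp add: P_def poly_pcompose poly_monom del: inverse_eq_1_iff)
  qed
  have sym: "poly (P i) (inverse (zeta_n N ^ j)) = (-1) ^ k * poly (P i) (zeta_n N ^ j)"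
    if "i \<in> I" "coprime j N" for i j
  proof -
    obtain q a where i: "i = (q, a)" "q \<in> Q" "a \<in> half_totatives q" using \<open>i \<in> I\<close> by (auto simp: I_def)
    have "zeta_n q ^ (a * j) \<noteq> 1" using unit[OF i(2,3) that(2)] by (intro ne1) auto
    hence "E (inverse (zeta_n q ^ (a * j))) = (-1) ^ k * E (zeta_n q ^ (a * j))"
      unfolding E_def n(2) by (intro cot_deriv_poly_inverse n) auto
    thus ?thesis using Pval[OF i(2,3) that(2)] Pinv[OF i(2,3) that(2)] by (simp add: i)
  qed
  have conv: "(\<Sum>q\<in>Q. \<Sum>a\<in>half_totatives q. c q a * hurwitz_pair k q (a * j mod q))
      = \<kappa> * (\<Sum>i\<in>I. d i * poly (P i) (zeta_n N ^ j))" if j: "coprime j N" for j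
  proof -
    have "(\<Sum>q\<in>Q. \<Sum>a\<in>half_totatives q. c q a * hurwitz_pair k q (a * j mod q))
        = (\<Sum>(q, a)\<in>I. c q a * hurwitz_pair k q (a * j mod q))"
      unfolding I_def using finQ by (subst sum.Sigma) auto
    also have "\<dots> = (\<Sum>i\<in>I. \<kappa> * (d i * poly (P i) (zeta_n N ^ j)))"
    proof (intro sum.cong refl, clarify)
      fix q a assume "(q, a) \<in> I"
      hence i: "q \<in> Q" "a \<in> half_totatives q" by (auto simp: I_def)
      note u = unit[OF this j]
      have "coprime j q" using u(1) by simp
      hence "a * j mod q \<in> totatives q" using u by (intro totatives_mult_mod) auto
      hence "hurwitz_pair k q (a * j mod q) = \<kappa> * E (zeta_n q ^ (a * j mod q))"
        using u(2) totatives_less[of _ q] by (intro pair) (auto simp: in_totatives_iff)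
      also have "zeta_n q ^ (a * j mod q) = zeta_n q ^ (a * j)"
        by (rule zeta_n_power_cong) simp
      finally show "c q a * hurwitz_pair k q (a * j mod q) = \<kappa> * (d (q, a) * poly (P (q, a)) (zeta_n N ^ j))"
        using Pval[OF i j] by (simp add: d_def)
    qed
    finally show ?thesis by (simp add: sum_distrib_left)
  qed
  have "(\<Sum>q\<in>Q. \<Sum>a\<in>half_totatives q. c q a * hurwitz_pair k q (a * 1 mod q)) = 0"
    unfolding rel[symmetric] using unit[of _ _ 1] by (intro sum.cong refl) simp
  hence rel0: "(\<Sum>i\<in>I. d i * poly (P i) (zeta_n N)) = 0"
    using conv[of 1] \<kappa> by simp
  have dK: "d i \<in> K" if "i \<in> I" for i using that c by (auto simp: I_def d_def)
  have PQ: "P i \<in> poly_over \<rat>" if "i \<in> I" for i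
    using that G(1) unfolding I_def P_def
    by (auto intro!: poly_over_pcompose[OF subfield_Rats]) (auto simp: poly_over_def)
  have "(\<Sum>i\<in>I. d i * poly (P i) (zeta_n N ^ h)) = 0"
  proof (cases "even k")
    case True
    show ?thesis
      by (rule symmetric_relation_conjugate[OF K KN _ h dK PQ _ rel0]) (use N sym True in auto)
  next
    case False
    show ?thesis
      by (rule antisymmetric_relation_conjugate[OF K KN N h dK PQ _ rel0]) (use sym False in auto)
  qed
  thus ?thesis using conv[OF h] by simp
qed

text \<open>The constant \<open>\<mu>\<close> cannot be avoided for even k: the generators of one
  modulus add up to a rational multiple of zeta(k), which can be traded against the same multiple
  from another modulus.\<close>

lemma hurwitz_pair_relation:
  assumes K: "subfield_C K" and k: "k > 1" and finQ: "finite Q" and Q2: "\<And>q. q \<in> Q \<Longrightarrow> q > 2"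
    and cop: "\<And>q r. q \<in> Q \<Longrightarrow> r \<in> Q \<Longrightarrow> q \<noteq> r \<Longrightarrow> coprime q r"
    and KN: "K \<inter> cyclotomic_plus (\<Prod>Q) = \<rat>"
    and c: "\<And>q a. q \<in> Q \<Longrightarrow> a \<in> half_totatives q \<Longrightarrow> c q a \<in> K"
    and rel: "(\<Sum>q\<in>Q. \<Sum>a\<in>half_totatives q. c q a * hurwitz_pair k q a) = 0"
    and q: "q \<in> Q"
  shows "\<exists>\<mu>. (odd k \<longrightarrow> \<mu> = 0) \<and> (\<forall>a\<in>half_totatives q. c q a = \<mu>)"
proof -
  define N where "N = \<Prod>Q"
  define R where "R = \<Prod>(Q - {q})"
  have NR: "N = q * R" unfolding N_def R_def using finQ q by (rule prod.remove)
  have q2: "q > 2" by (rule Q2[OF q])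
  have R0: "R > 0" unfolding R_def using Q2 by (intro prod_pos) fastforce
  have N2: "N > 2" using q2 R0 by (simp add: NR less_le_trans[of 2 q])
  have qR: "coprime q R" unfolding R_def using cop q by (intro prod_coprime_right) auto
  have QN: "r dvd N" if "r \<in> Q" for r unfolding N_def using that finQ by (intro dvd_prodI) auto
  define F where "F = (\<lambda>r h. \<Sum>a\<in>half_totatives r. c r a * hurwitz_pair k r (a * h mod r))"
  have F0: "(\<Sum>r\<in>Q. F r h) = 0" if "coprime h N" for h
    unfolding F_def
    by (rule hurwitz_pair_relation_conjugate[OF K k finQ Q2 QN N2 _ c rel that]) (use KN in \<open>auto simp: N_def\<close>)
  have Fcong: "F r h = F r h'" if "[h = h'] (mod r)" for r h h'
  proof -
    have "a * h mod r = a * h' mod r" for a using that by (metis cong_def cong_scalar_left)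
    thus ?thesis by (simp add: F_def)
  qed
  have const: "F q h = F q 1" if h: "coprime h q" for h
  proof -
    \<comment> \<open>H agrees with h modulo q and with 1 modulo all other moduli, so only the
      summand of q can change.\<close>
    obtain H where H: "coprime H N" "[H = h] (mod q)" "[H = 1] (mod R)"
      using chinese_remainder_coprime_unique[OF qR _ _ h coprime_1_left] q2 R0 unfolding NR by auto
    have "F r H = F r 1" if "r \<in> Q - {q}" for r
    proof -
      have "r dvd R" unfolding R_def using that finQ by (intro dvd_prodI) auto
      thus ?thesis using H(3) by (intro Fcong) (rule cong_dvd_modulus_nat)
    qed
    hence "(\<Sum>r\<in>Q - {q}. F r H) = (\<Sum>r\<in>Q - {q}. F r 1)" by (intro sum.cong) auto
    moreover have "F q H + (\<Sum>r\<in>Q - {q}. F r H) = F q 1 + (\<Sum>r\<in>Q - {q}. F r 1)"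
      using F0[OF H(1)] F0[of 1] sum.remove[OF finQ q, of "\<lambda>r. F r H"] sum.remove[OF finQ q, of "\<lambda>r. F r 1"]
      by simp
    ultimately have "F q H = F q 1" by simp
    thus ?thesis using Fcong[OF H(2)] by simp
  qed
  define T where "T = totatives q"
  define A where "A = half_totatives q"
  have AT: "A \<subseteq> T" unfolding A_def T_def by (rule half_totatives_subset[OF q2])
  have Tq: "a < q" "a > 0" "coprime a q" if "a \<in> T" for a
    using that q2 totatives_less[of a q] by (auto simp: T_def in_totatives_iff)
  \<comment> \<open>Extends the coefficients to all residues prime to q with the parity of k, as
    \<open>hurwitz_pair_kernel\<close> requires; a and q - a then contribute equally, which is the
    factor 2 in \<open>dF\<close>.\<close>
  define d where "d = (\<lambda>a. if a \<in> A then c q a else (-1) ^ k * c q (q - a))"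
  have sgn: "(-1) ^ k * ((-1) ^ k * x) = x" for x :: complex
    by (simp add: mult.assoc[symmetric] flip: power_mult_distrib)
  have dsym: "d (q - a) = (-1) ^ k * d a" if "a \<in> T" for a
    using totatives_reflect_half_iff[OF q2, of a] Tq[OF that] that
    by (auto simp: d_def A_def T_def sgn)
  have pair_sym: "hurwitz_pair k q (q - a) = (-1) ^ k * hurwitz_pair k q a" if "a \<in> T" for a
  proof -
    have "real (q - a) / real q = 1 - real a / real q"
      using Tq[OF that] by (simp add: of_nat_diff field_simps)
    thus ?thesis by (simp add: hurwitz_pair_def distrib_left sgn add.commute)
  qed
  have mem: "a * h mod q \<in> T" if "a \<in> T" "coprime h q" for a h
    unfolding T_def using that Tq q2 by (intro totatives_mult_mod) auto
  have refl_mod: "(q - a) * h mod q = q - a * h mod q" if "a \<in> T" "coprime h q" for a h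
    using that q2 by (intro totatives_reflect_mult_mod) (auto simp: T_def)
  have dF: "(\<Sum>a\<in>T. d a * hurwitz_pair k q (a * h mod q)) = 2 * F q h" if h: "coprime h q" for h
  proof -
    have "(\<Sum>a\<in>T. d a * hurwitz_pair k q (a * h mod q))
        = (\<Sum>a\<in>A. d a * hurwitz_pair k q (a * h mod q) + d (q - a) * hurwitz_pair k q ((q - a) * h mod q))"
      unfolding T_def A_def by (rule sum_totatives_split[OF q2])
    also have "\<dots> = (\<Sum>a\<in>A. 2 * (c q a * hurwitz_pair k q (a * h mod q)))"
    proof (intro sum.cong refl)
      fix a assume a: "a \<in> A"
      hence aT: "a \<in> T" using AT by auto
      have "d (q - a) * hurwitz_pair k q ((q - a) * h mod q)
          = (-1) ^ k * ((-1) ^ k * (d a * hurwitz_pair k q (a * h mod q)))"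
        using refl_mod[OF aT h] dsym[OF aT] pair_sym[OF mem[OF aT h]] by simp
      thus "d a * hurwitz_pair k q (a * h mod q) + d (q - a) * hurwitz_pair k q ((q - a) * h mod q)
          = 2 * (c q a * hurwitz_pair k q (a * h mod q))"
        using a by (simp add: sgn d_def)
    qed
    finally show ?thesis by (simp add: F_def A_def sum_distrib_left)
  qed
  define W where "W = (\<Sum>a\<in>T. hurwitz_pair k q a)"
  have W: "(\<Sum>a\<in>T. hurwitz_pair k q (a * h mod q)) = W" if h: "coprime h q" for h
    unfolding W_def T_def using q2 h
    by (intro sum.reindex_bij_betw[OF bij_betw_totatives_mult_mod]) auto
  have W0: "W \<noteq> 0" if "even k"
  proof -
    have "W = of_real (\<Sum>a\<in>T. hurwitz_zeta k (real a / real q) + hurwitz_zeta k (1 - real a / real q))"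
      using that by (simp add: W_def hurwitz_pair_def)
    moreover have "(\<Sum>a\<in>T. hurwitz_zeta k (real a / real q) + hurwitz_zeta k (1 - real a / real q)) > 0"
      using Tq q2 k by (intro sum_pos add_pos_pos hurwitz_zeta_pos) (auto simp: T_def)
    ultimately show ?thesis by (metis of_real_eq_0_iff less_irrefl)
  qed
  \<comment> \<open>h = q - 1 acts as -1 and changes the sign of every pair when k is odd, whereas
    \<open>F q h\<close> does not depend on h.\<close>
  have Fodd: "F q 1 = 0" if "odd k"
  proof -
    have "F q (q - 1) = - F q 1"
      unfolding F_def sum_negf[symmetric]
    proof (intro sum.cong refl)
      fix a assume "a \<in> half_totatives q"
      hence a: "a \<in> T" using AT by (auto simp: A_def)
      have "a * (q - 1) mod q = (q - 1) * a mod q" by (simp add: mult.commute)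
      also have "\<dots> = q - 1 * a mod q"
        by (rule refl_mod) (use q2 a Tq in \<open>auto simp: T_def\<close>)
      also have "\<dots> = q - a" using Tq[OF a] by simp
      finally show "c q a * hurwitz_pair k q (a * (q - 1) mod q) = - (c q a * hurwitz_pair k q (a * 1 mod q))"
        using pair_sym[OF a] that Tq[OF a] by simp
    qed
    moreover have "coprime (q - 1) q" using minus_one_in_totatives[of q] q2 by (simp add: in_totatives_iff)
    ultimately show ?thesis using const[of "q - 1"] by simp
  qed
  \<comment> \<open>Chosen so that subtracting it cancels the constant 2 F: the sum W of the pairs
    over all residues prime to q is the same for every h, and nonzero for even k.\<close>
  define \<mu> where "\<mu> = (if odd k then 0 else 2 * F q 1 / W)"
  have "d a - \<mu> = 0" if "a \<in> T" for a
  proof (rule hurwitz_pair_kernel[OF k q2, where b = "\<lambda>a. d a - \<mu>"])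
    show "a \<in> totatives q" using that by (simp add: T_def)
    show "d (q - a) - \<mu> = (-1) ^ k * (d a - \<mu>)" if "a \<in> totatives q" for a
      using dsym[of a] that by (simp add: T_def \<mu>_def)
    fix h :: nat assume h: "coprime h q"
    have "(\<Sum>a\<in>T. (d a - \<mu>) * hurwitz_pair k q (a * h mod q)) = 2 * F q h - \<mu> * W"
      using dF[OF h] W[OF h] by (simp add: left_diff_distrib sum_subtractf flip: sum_distrib_left)
    also have "\<dots> = 0" using const[OF h] Fodd W0 by (auto simp: \<mu>_def)
    finally show "(\<Sum>a\<in>totatives q. (d a - \<mu>) * hurwitz_pair k q (a * h mod q)) = 0" by (simp add: T_def)
  qed
  hence "c q a = \<mu>" if "a \<in> half_totatives q" for a
    using that AT by (force simp: d_def A_def)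
  moreover have "odd k \<longrightarrow> \<mu> = 0" by (simp add: \<mu>_def)
  ultimately show ?thesis by blast
qed

text \<open>For even k the pair at a adds the values at a and q - a, so the sum runs over all
  residues prime to q; positivity excludes r = 0.\<close>

lemma sum_hurwitz_pair:
  assumes k: "k > 1" "even k" and q: "q > 2"
  shows "\<exists>r\<in>\<rat>. r \<noteq> 0 \<and>
    (\<Sum>a\<in>half_totatives q. hurwitz_pair k q a) = r * complex_of_real (hurwitz_zeta k 1)"
proof -
  obtain r where r: "r \<in> \<rat>" "(\<Sum>a\<in>totatives q. hurwitz_zeta k (real a / real q)) = r * hurwitz_zeta k 1"
    using sum_totatives_hurwitz_zeta[OF k(1), of q] q by auto
  have "(\<Sum>a\<in>totatives q. hurwitz_zeta k (real a / real q))
      = (\<Sum>a\<in>half_totatives q. hurwitz_zeta k (real a / real q) + hurwitz_zeta k (real (q - a) / real q))"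
    by (rule sum_totatives_split[OF q])
  also have "complex_of_real \<dots> = (\<Sum>a\<in>half_totatives q. hurwitz_pair k q a)"
    unfolding of_real_sum
  proof (intro sum.cong refl)
    fix a assume "a \<in> half_totatives q"
    hence "a \<le> q" by (auto simp: half_totatives_def)
    hence "real (q - a) / real q = 1 - real a / real q"
      using q by (simp add: of_nat_diff field_simps)
    thus "complex_of_real (hurwitz_zeta k (real a / real q) + hurwitz_zeta k (real (q - a) / real q))
        = hurwitz_pair k q a" using k by (simp add: hurwitz_pair_def)
  qed
  finally have "(\<Sum>a\<in>half_totatives q. hurwitz_pair k q a) = of_real r * complex_of_real (hurwitz_zeta k 1)"
    using r by simp
  moreover have "(\<Sum>a\<in>totatives q. hurwitz_zeta k (real a / real q)) > 0"
    using q k by (intro sum_pos hurwitz_zeta_pos) (auto simp: in_totatives_iff)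
  hence "r \<noteq> 0" using r by auto
  moreover have "complex_of_real r \<in> \<rat>" using r(1) by (auto elim!: Rats_cases')
  ultimately show ?thesis by (intro bexI[of _ "of_real r"]) auto
qed

section \<open>Linear algebra over a subfield\<close>

context
  fixes K :: "complex set"
  assumes K: "subfield_C K"
begin

lemma K_closed: "0 \<in> K" "1 \<in> K" "x \<in> K \<Longrightarrow> y \<in> K \<Longrightarrow> x + y \<in> K" "x \<in> K \<Longrightarrow> y \<in> K \<Longrightarrow> x * y \<in> K"
  "x \<in> K \<Longrightarrow> - x \<in> K" "x \<in> K \<Longrightarrow> y \<in> K \<Longrightarrow> x - y \<in> K" "x \<in> K \<Longrightarrow> y \<in> K \<Longrightarrow> x / y \<in> K"
  using K subfield_diff[OF K] subfield_divide[OF K] by (auto simp: subfield_C_def)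

text \<open>Passes from sets to indexed families. Where \<open>v\<close> is not injective, an
  injective choice of indices gives one inclusion, and adding up the coefficients of equal vectors
  gives the other.\<close>

lemma K_span_image:
  assumes "finite I"
  shows "K_span K (v ` I) = {\<Sum>i\<in>I. c i * v i | c. \<forall>i\<in>I. c i \<in> K}"
proof safe
  fix x assume "x \<in> K_span K (v ` I)"
  then obtain F c where F: "finite F" "F \<subseteq> v ` I" "\<forall>y\<in>F. c y \<in> K" "x = (\<Sum>y\<in>F. c y * y)"
    unfolding K_span_def by blast
  obtain J where J: "J \<subseteq> I" "inj_on v J" "F = v ` J" using F(2) by (meson subset_image_inj)
  have "x = (\<Sum>i\<in>J. c (v i) * v i)" unfolding F(4) J(3) using J(2) by (simp add: sum.reindex)
  also have "\<dots> = (\<Sum>i\<in>I. (if i \<in> J then c (v i) else 0) * v i)"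
    by (rule sum.mono_neutral_cong_left) (use J assms in auto)
  finally show "\<exists>c. x = (\<Sum>i\<in>I. c i * v i) \<and> (\<forall>i\<in>I. c i \<in> K)"
    using F(3) J(3) by (intro exI[of _ "\<lambda>i. if i \<in> J then c (v i) else 0"]) (auto simp: K_closed)
next
  fix c assume c: "\<forall>i\<in>I. c i \<in> K"
  define e where "e = (\<lambda>y. \<Sum>i\<in>{i\<in>I. v i = y}. c i)"
  have "(\<Sum>i\<in>I. c i * v i) = (\<Sum>y\<in>v ` I. \<Sum>i\<in>{i\<in>I. v i = y}. c i * v i)"
    by (rule sum.image_gen[OF assms])
  also have "\<dots> = (\<Sum>y\<in>v ` I. e y * y)"
    unfolding e_def sum_distrib_right by (intro sum.cong refl) auto
  finally show "(\<Sum>i\<in>I. c i * v i) \<in> K_span K (v ` I)"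
    unfolding K_span_def using c assms
    by (auto intro!: exI[of _ "v ` I"] exI[of _ e] subfield_sum[OF K] simp: e_def)
qed

lemma K_span_superset: "S \<subseteq> K_span K S"
proof
  fix x assume "x \<in> S"
  thus "x \<in> K_span K S" unfolding K_span_def
    by (auto intro!: exI[of _ "{x}"] exI[of _ "\<lambda>_. 1"] simp: K_closed)
qed

lemma K_span_0: "0 \<in> K_span K S"
  unfolding K_span_def by (auto intro!: exI[of _ "{}"])

lemma K_span_scale: "c \<in> K \<Longrightarrow> x \<in> K_span K S \<Longrightarrow> c * x \<in> K_span K S"
proof -
  assume c: "c \<in> K" and "x \<in> K_span K S"
  then obtain F d where F: "finite F" "F \<subseteq> S" "\<forall>y\<in>F. d y \<in> K" "x = (\<Sum>y\<in>F. d y * y)"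
    unfolding K_span_def by blast
  have "c * x = (\<Sum>y\<in>F. (c * d y) * y)" by (simp add: F(4) sum_distrib_left mult.assoc)
  thus ?thesis unfolding K_span_def using F c K_closed(4)
    by (auto intro!: exI[of _ F] exI[of _ "\<lambda>y. c * d y"])
qed

lemma K_span_add:
  assumes "x \<in> K_span K S" "y \<in> K_span K S"
  shows "x + y \<in> K_span K S"
proof -
  obtain F d where F: "finite F" "F \<subseteq> S" "\<forall>y\<in>F. d y \<in> K" "x = (\<Sum>y\<in>F. d y * y)"
    using assms(1) unfolding K_span_def by blast
  obtain G e where G: "finite G" "G \<subseteq> S" "\<forall>y\<in>G. e y \<in> K" "y = (\<Sum>y\<in>G. e y * y)"
    using assms(2) unfolding K_span_def by blast
  define f where "f = (\<lambda>z. (if z \<in> F then d z else 0) + (if z \<in> G then e z else 0))"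
  have "x = (\<Sum>z\<in>F \<union> G. (if z \<in> F then d z else 0) * z)"
    unfolding F(4) by (rule sum.mono_neutral_cong_left) (use F G in auto)
  moreover have "y = (\<Sum>z\<in>F \<union> G. (if z \<in> G then e z else 0) * z)"
    unfolding G(4) by (rule sum.mono_neutral_cong_left) (use F G in auto)
  ultimately have "x + y = (\<Sum>z\<in>F \<union> G. f z * z)"
    by (simp add: f_def distrib_right sum.distrib)
  moreover have "\<forall>z\<in>F \<union> G. f z \<in> K" using F G by (auto simp: f_def K_closed)
  ultimately show ?thesis unfolding K_span_def using F G by blast
qed

lemma K_span_diff: "x \<in> K_span K S \<Longrightarrow> y \<in> K_span K S \<Longrightarrow> x - y \<in> K_span K S"
  using K_span_add[of x S "-1 * y"] K_span_scale[of "-1" y S] K_closed(2,5) by simp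

lemma K_span_sum: "(\<And>i. i \<in> I \<Longrightarrow> f i \<in> K_span K S) \<Longrightarrow> sum f I \<in> K_span K S"
  by (induction I rule: infinite_finite_induct) (auto intro: K_span_add K_span_0)

lemma K_span_minimal:
  assumes "S \<subseteq> K_span K T"
  shows "K_span K S \<subseteq> K_span K T"
proof
  fix x assume "x \<in> K_span K S"
  then obtain F d where F: "finite F" "F \<subseteq> S" "\<forall>y\<in>F. d y \<in> K" "x = (\<Sum>y\<in>F. d y * y)"
    unfolding K_span_def by blast
  thus "x \<in> K_span K T" using assms by (auto intro!: K_span_sum K_span_scale)
qed

lemma K_span_eqI: "S \<subseteq> K_span K T \<Longrightarrow> T \<subseteq> K_span K S \<Longrightarrow> K_span K S = K_span K T"
  by (intro antisym K_span_minimal)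

lemma K_span_idem: "K_span K (K_span K S) = K_span K S"
  by (intro antisym K_span_minimal K_span_superset order.refl)

lemma K_span_UN: "K_span K (\<Union>i\<in>I. K_span K (S i)) = K_span K (\<Union>i\<in>I. S i)"
proof (rule K_span_eqI)
  show "(\<Union>i\<in>I. K_span K (S i)) \<subseteq> K_span K (\<Union>i\<in>I. S i)"
  proof safe
    fix i x assume "i \<in> I" "x \<in> K_span K (S i)"
    moreover have "S i \<subseteq> K_span K (\<Union>i\<in>I. S i)" if "i \<in> I"
      using K_span_superset[of "\<Union>i\<in>I. S i"] that by blast
    ultimately show "x \<in> K_span K (\<Union>i\<in>I. S i)"
      using K_span_minimal[of "S i" "\<Union>i\<in>I. S i"] by auto
  qed
  show "(\<Union>i\<in>I. S i) \<subseteq> K_span K (\<Union>i\<in>I. K_span K (S i))"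
  proof (rule UN_least)
    fix i assume "i \<in> I"
    have "S i \<subseteq> K_span K (S i)" by (rule K_span_superset)
    also have "\<dots> \<subseteq> (\<Union>i\<in>I. K_span K (S i))" using \<open>i \<in> I\<close> by (rule UN_upper)
    also have "\<dots> \<subseteq> K_span K (\<Union>i\<in>I. K_span K (S i))" by (rule K_span_superset)
    finally show "S i \<subseteq> K_span K (\<Union>i\<in>I. K_span K (S i))" .
  qed
qed

lemma K_span_scale_singleton:
  assumes "c \<in> K" "c \<noteq> 0"
  shows "K_span K {c * x} = K_span K {x}"
proof (rule K_span_eqI)
  show "{c * x} \<subseteq> K_span K {x}"
    using K_span_scale[OF assms(1), of x "{x}"] K_span_superset[of "{x}"] by blast
  have "1 / c \<in> K" by (intro K_closed assms)
  moreover have "c * x \<in> K_span K {c * x}" using K_span_superset[of "{c * x}"] by simp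
  ultimately have "1 / c * (c * x) \<in> K_span K {c * x}" by (rule K_span_scale)
  thus "{x} \<subseteq> K_span K {c * x}" using assms(2) by simp
qed

text \<open>Gaussian elimination by induction on the equations \<open>S\<close>; the unknowns are
  indexed by the larger set \<open>B\<close>.\<close>

lemma homogeneous_system_nontrivial:
  assumes "finite S"
  shows "finite B \<Longrightarrow> card S < card B \<Longrightarrow> (\<And>b s. b \<in> B \<Longrightarrow> s \<in> S \<Longrightarrow> m b s \<in> K) \<Longrightarrow>
    \<exists>x. (\<forall>b\<in>B. x b \<in> K) \<and> (\<exists>b\<in>B. x b \<noteq> 0) \<and> (\<forall>s\<in>S. (\<Sum>b\<in>B. x b * m b s) = 0)"
  using assms
proof (induction S arbitrary: B m rule: finite_induct)
  case empty
  hence "B \<noteq> {}" by auto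
  thus ?case by (intro exI[of _ "\<lambda>_. 1"]) (auto simp: K_closed)
next
  case (insert s S)
  show ?case
  proof (cases "\<forall>b\<in>B. m b s = 0")
    case True
    have "\<exists>x. (\<forall>b\<in>B. x b \<in> K) \<and> (\<exists>b\<in>B. x b \<noteq> 0) \<and> (\<forall>s\<in>S. (\<Sum>b\<in>B. x b * m b s) = 0)"
      using insert by (intro insert.IH) auto
    thus ?thesis using True by auto
  next
    case False
    then obtain p where p: "p \<in> B" "m p s \<noteq> 0" by blast
    \<comment> \<open>The coefficients after equation \<open>s\<close> has been solved for the
      unknown at the pivot \<open>p\<close>; \<open>y\<close> later puts that solution back.\<close>
    define m' where "m' = (\<lambda>b t. m b t - m b s / m p s * m p t)"
    have "\<exists>x. (\<forall>b\<in>B - {p}. x b \<in> K) \<and> (\<exists>b\<in>B - {p}. x b \<noteq> 0) \<and> (\<forall>t\<in>S. (\<Sum>b\<in>B - {p}. x b * m' b t) = 0)"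
    proof (rule insert.IH)
      show "card S < card (B - {p})" using insert p by simp
      show "m' b t \<in> K" if "b \<in> B - {p}" "t \<in> S" for b t
        unfolding m'_def using that p insert.prems(3) by (auto intro!: K_closed)
    qed (use insert in auto)
    then obtain x where x: "\<forall>b\<in>B - {p}. x b \<in> K" "\<exists>b\<in>B - {p}. x b \<noteq> 0"
      "\<forall>t\<in>S. (\<Sum>b\<in>B - {p}. x b * m' b t) = 0" by blast
    define y where "y = x(p := - (\<Sum>b\<in>B - {p}. x b * (m b s / m p s)))"
    have split: "(\<Sum>b\<in>B. y b * m b t) = (\<Sum>b\<in>B - {p}. x b * m' b t)" for t
    proof -
      have "(\<Sum>b\<in>B. y b * m b t) = y p * m p t + (\<Sum>b\<in>B - {p}. y b * m b t)"
        by (rule sum.remove) (use insert p in auto)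
      also have "(\<Sum>b\<in>B - {p}. y b * m b t) = (\<Sum>b\<in>B - {p}. x b * m b t)"
        by (intro sum.cong) (auto simp: y_def)
      also have "y p * m p t = - (\<Sum>b\<in>B - {p}. x b * (m b s / m p s * m p t))"
        by (simp add: y_def sum_distrib_right mult.assoc)
      finally show ?thesis
        by (simp add: m'_def right_diff_distrib sum_subtractf)
    qed
    have "m' b s = 0" for b using p by (simp add: m'_def)
    hence "\<forall>t\<in>insert s S. (\<Sum>b\<in>B. y b * m b t) = 0" using x(3) by (auto simp: split)
    moreover have "\<forall>b\<in>B. y b \<in> K"
      using x(1) p insert.prems(3) by (auto simp: y_def intro!: K_closed subfield_sum[OF K])
    moreover have "\<exists>b\<in>B. y b \<noteq> 0" using x(2) by (auto simp: y_def)
    ultimately show ?thesis by blast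
  qed
qed

text \<open>With more vectors than generators, the coordinates form a homogeneous system with a
  nontrivial solution, that is, a relation among the vectors.\<close>

lemma K_indep_card_le:
  assumes B: "finite B" "K_indep K B" and S: "finite S" "B \<subseteq> K_span K S"
  shows "card B \<le> card S"
proof (rule ccontr)
  assume "\<not> card B \<le> card S"
  have "\<forall>b\<in>B. \<exists>c. b = (\<Sum>s\<in>S. c s * s) \<and> (\<forall>s\<in>S. c s \<in> K)"
    using S(2) K_span_image[OF S(1), of "\<lambda>s. s"] by auto
  then obtain m where m: "\<And>b. b \<in> B \<Longrightarrow> b = (\<Sum>s\<in>S. m b s * s)" "\<And>b s. b \<in> B \<Longrightarrow> s \<in> S \<Longrightarrow> m b s \<in> K"
    by metis
  obtain x where x: "\<forall>b\<in>B. x b \<in> K" "\<exists>b\<in>B. x b \<noteq> 0" "\<forall>s\<in>S. (\<Sum>b\<in>B. x b * m b s) = 0"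
    using homogeneous_system_nontrivial[OF S(1) B(1), of m] m(2) \<open>\<not> card B \<le> card S\<close> by auto
  have "(\<Sum>b\<in>B. x b * b) = (\<Sum>b\<in>B. \<Sum>s\<in>S. x b * m b s * s)"
    by (intro sum.cong refl, subst (2) m(1)) (auto simp: sum_distrib_left mult.assoc)
  also have "\<dots> = (\<Sum>s\<in>S. (\<Sum>b\<in>B. x b * m b s) * s)"
    unfolding sum_distrib_right by (rule sum.swap)
  also have "\<dots> = 0" using x(3) by simp
  finally show False using B x(1,2) unfolding K_indep_def by blast
qed

text \<open>\<open>K_dim\<close> counts an arbitrarily chosen basis, so its size is compared with
  that of the image of \<open>v\<close> in both directions. Independence is stated for the indexed
  family and therefore also yields injectivity of \<open>v\<close>.\<close>

lemma K_dim_eq_card: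
  assumes I: "finite I"
    and ind: "\<And>c. (\<And>i. i \<in> I \<Longrightarrow> c i \<in> K) \<Longrightarrow> (\<Sum>i\<in>I. c i * v i) = 0 \<Longrightarrow> \<forall>i\<in>I. c i = 0"
  shows "K_dim K (K_span K (v ` I)) = card I"
proof -
  have inj: "inj_on v I"
  proof (rule inj_onI, rule ccontr)
    fix i j assume ij: "i \<in> I" "j \<in> I" "v i = v j" "i \<noteq> j"
    define c :: "'a \<Rightarrow> complex" where "c = (\<lambda>_. 0)(i := 1, j := -1)"
    have "(\<Sum>k\<in>I. c k * v k) = (\<Sum>k\<in>{i,j}. c k * v k)"
      by (rule sum.mono_neutral_right) (use ij I in \<open>auto simp: c_def\<close>)
    also have "\<dots> = 0" using ij by (simp add: c_def)
    finally have "\<forall>k\<in>I. c k = 0" by (intro ind) (auto simp: c_def K_closed)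
    thus False using ij by (auto simp: c_def)
  qed
  have "K_indep K (v ` I)"
    unfolding K_indep_def
  proof (intro allI impI)
    fix F c assume F: "finite F \<and> F \<subseteq> v ` I \<and> (\<forall>v\<in>F. c v \<in> K) \<and> (\<Sum>v\<in>F. c v * v) = 0"
    define e where "e = (\<lambda>i. if v i \<in> F then c (v i) else 0)"
    define J where "J = {i\<in>I. v i \<in> F}"
    have "F = v ` J" using F by (auto simp: J_def)
    moreover have "inj_on v J" using inj by (rule inj_on_subset) (auto simp: J_def)
    ultimately have "(\<Sum>y\<in>F. c y * y) = (\<Sum>i\<in>J. c (v i) * v i)" by (simp add: sum.reindex)
    also have "\<dots> = (\<Sum>i\<in>I. e i * v i)"
      by (rule sum.mono_neutral_cong_left) (use I in \<open>auto simp: J_def e_def\<close>)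
    finally have "(\<Sum>i\<in>I. e i * v i) = 0" using F by simp
    hence "\<forall>i\<in>I. e i = 0" using F by (intro ind) (auto simp: e_def K_closed)
    thus "\<forall>y\<in>F. c y = 0" using F by (force simp: e_def)
  qed
  hence B: "K_basis K (K_span K (v ` I)) (v ` I)" using I by (simp add: K_basis_def)
  define C where "C = (SOME B. K_basis K (K_span K (v ` I)) B)"
  have C: "K_basis K (K_span K (v ` I)) C" unfolding C_def using B by (rule someI)
  have "card C = card (v ` I)"
  proof (rule antisym)
    show "card C \<le> card (v ` I)"
      using B C K_span_superset[of C] by (intro K_indep_card_le) (auto simp: K_basis_def)
    show "card (v ` I) \<le> card C"
      using B C K_span_superset[of "v ` I"] by (intro K_indep_card_le) (auto simp: K_basis_def)
  qed
  thus ?thesis unfolding K_dim_def using B card_image[OF inj] by (auto simp: C_def)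
qed

end

section \<open>Dimensions\<close>

text \<open>Lets the disjointness hypothesis be used for any divisor of the product of the
  moduli.\<close>

lemma cyclotomic_plus_mono:
  assumes "m dvd N" "N > 0"
  shows "cyclotomic_plus m \<subseteq> cyclotomic_plus N"
proof -
  have "zeta_n m \<in> cyclotomic_field N"
    using subfield_power[OF subfield_cyclotomic_field zeta_n_in_cyclotomic_field, of N "N div m"]
      zeta_n_divisor[OF assms] by simp
  hence "cyclotomic_field m \<subseteq> cyclotomic_field N"
    using subfield_cyclotomic_field[of N] by (auto simp: cyclotomic_field_def[of m])
  thus ?thesis by (auto simp: cyclotomic_plus_def)
qed

lemma Vplus_eq_span: "q > 2 \<Longrightarrow> Vplus K k q = K_span K (hurwitz_pair k q ` half_totatives q)"
  by (auto simp: Vplus_def hurwitz_pair_def half_totatives_def intro!: arg_cong[of _ _ "K_span K"])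

text \<open>For q = 1 and q = 2 the only residue is 1, so zeta(k, 1/q) is by itself a sum over all
  residues prime to q, hence a rational multiple of zeta(k).\<close>

lemma Vplus_small:
  assumes K: "subfield_C K" and k: "k > 1" and q: "q \<in> {1, 2}"
  shows "Vplus K k q = K_span K {if even k then complex_of_real (hurwitz_zeta k 1) else 0}"
proof -
  obtain r where r: "r \<in> \<rat>" "hurwitz_zeta k (1 / real q) = r * hurwitz_zeta k 1"
  proof -
    have "totatives q = {1}" using q by (auto simp: totatives_def elim!: oddE)
    thus ?thesis using sum_totatives_hurwitz_zeta[OF k, of q] q that by auto
  qed
  have "hurwitz_zeta k (1 / real q) > 0" using q k by (intro hurwitz_zeta_pos) auto
  hence r0: "r \<noteq> 0" using r by auto
  have V: "Vplus K k q = K_span K {complex_of_real (hurwitz_zeta k (1 / real q) * (1 + (-1) ^ k))}"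
    using q by (auto simp: Vplus_def)
  show ?thesis
  proof (cases "even k")
    case True
    have "complex_of_real r \<in> \<rat>" using r(1) by (auto elim!: Rats_cases')
    hence "2 * complex_of_real r \<in> K" using Rats_subset_subfield[OF K] by (auto intro: Rats_mult)
    hence "K_span K {2 * of_real r * of_real (hurwitz_zeta k 1)} = K_span K {complex_of_real (hurwitz_zeta k 1)}"
      using r0 by (intro K_span_scale_singleton[OF K]) auto
    thus ?thesis using True by (simp add: V r mult_ac)
  qed (simp add: V)
qed

lemma K_dim_Vplus_small:
  assumes K: "subfield_C K" and k: "k > 1" and q: "q \<in> {1, 2}"
  shows "K_dim K (Vplus K k q) = (if even k then 1 else 0)"
proof (cases "even k")
  case True
  have "hurwitz_zeta k 1 > 0" using k by (intro hurwitz_zeta_pos) auto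
  hence "K_dim K (K_span K ((\<lambda>_. complex_of_real (hurwitz_zeta k 1)) ` {()})) = card {()}"
    by (intro K_dim_eq_card[OF K]) auto
  thus ?thesis using True by (simp add: Vplus_small[OF assms])
next
  case False
  have "K_span K {0 :: complex} = K_span K ((\<lambda>x. x) ` {})"
    using K_span_0[OF K] by (intro K_span_eqI[OF K]) auto
  also have "K_dim K \<dots> = card ({} :: complex set)"
    by (intro K_dim_eq_card[OF K]) auto
  finally show ?thesis using False by (simp add: Vplus_small[OF assms])
qed

text \<open>For even k, zeta(k) is a rational multiple of the sum of the generators. Hence the
  moduli 1 and 2 add nothing to a sum of spaces that involves a larger modulus.\<close>

lemma Vplus_1_subset:
  assumes K: "subfield_C K" and k: "k > 1" and q: "q > 2"
  shows "(if even k then complex_of_real (hurwitz_zeta k 1) else 0) \<in> Vplus K k q"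
proof (cases "even k")
  case True
  obtain r where r: "r \<in> \<rat>" "r \<noteq> 0"
    "(\<Sum>a\<in>half_totatives q. hurwitz_pair k q a) = r * complex_of_real (hurwitz_zeta k 1)"
    using sum_hurwitz_pair[OF k True q] by blast
  have "1 / r \<in> \<rat>" using r(1) by (intro Rats_divide) auto
  hence "1 / r \<in> K" using Rats_subset_subfield[OF K] by (rule rev_subsetD)
  moreover have "hurwitz_pair k q a \<in> Vplus K k q" if "a \<in> half_totatives q" for a
    unfolding Vplus_eq_span[OF q] using K_span_superset[OF K] that by blast
  hence "(\<Sum>a\<in>half_totatives q. hurwitz_pair k q a) \<in> Vplus K k q"
    unfolding Vplus_eq_span[OF q] by (intro K_span_sum[OF K])
  ultimately have "1 / r * (\<Sum>a\<in>half_totatives q. hurwitz_pair k q a) \<in> Vplus K k q"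
    unfolding Vplus_eq_span[OF q] by (rule K_span_scale[OF K])
  thus ?thesis using True r by simp
next
  case False
  thus ?thesis unfolding Vplus_eq_span[OF q] by (simp add: K_span_0[OF K])
qed

text \<open>For odd k the generators of all moduli together are independent. For even k a basis
  consists of zeta(k) and, for each q, the generators with a \<noteq> 1; the one at a = 1 comes back
  from the sum of all generators of q.\<close>

lemma K_dim_sum_Vplus:
  assumes K: "subfield_C K" and k: "k > 1" and finQ: "finite Q" and Q0: "Q \<noteq> {}"
    and Q2: "\<And>q. q \<in> Q \<Longrightarrow> q > 2"
    and cop: "\<And>q r. q \<in> Q \<Longrightarrow> r \<in> Q \<Longrightarrow> q \<noteq> r \<Longrightarrow> coprime q r"
    and KN: "K \<inter> cyclotomic_plus (\<Prod>Q) = \<rat>"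
  defines "\<epsilon> \<equiv> (if even k then 1 else 0 :: int)"
  shows "int (K_dim K (K_span K (\<Union>q\<in>Q. Vplus K k q)))
      = \<epsilon> + (\<Sum>q\<in>Q. int (card (half_totatives q)) - \<epsilon>)"
proof -
  let ?A = half_totatives and ?v = "hurwitz_pair k"
  have "(\<Union>q\<in>Q. Vplus K k q) = (\<Union>q\<in>Q. K_span K (?v q ` ?A q))"
    using Q2 by (simp add: Vplus_eq_span)
  hence span: "K_span K (\<Union>q\<in>Q. Vplus K k q) = K_span K (\<Union>q\<in>Q. ?v q ` ?A q)"
    by (simp add: K_span_UN[OF K])
  show ?thesis
  proof (cases "even k")
    case False
    define I where "I = Sigma Q ?A"
    have I: "finite I" using finQ by (auto simp: I_def)
    have "K_dim K (K_span K ((\<lambda>(q, a). ?v q a) ` I)) = card I"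
    proof (rule K_dim_eq_card[OF K I])
      fix c assume c: "\<And>i. i \<in> I \<Longrightarrow> c i \<in> K" and rel: "(\<Sum>i\<in>I. c i * (case i of (q, a) \<Rightarrow> ?v q a)) = 0"
      have rel': "(\<Sum>q\<in>Q. \<Sum>a\<in>?A q. c (q, a) * ?v q a) = 0"
        using rel finQ unfolding I_def by (subst sum.Sigma) (auto simp: case_prod_unfold)
      show "\<forall>i\<in>I. c i = 0"
      proof
        fix i assume "i \<in> I"
        then obtain q a where i: "i = (q, a)" "q \<in> Q" "a \<in> ?A q" by (auto simp: I_def)
        have "\<exists>\<mu>. (odd k \<longrightarrow> \<mu> = 0) \<and> (\<forall>a\<in>?A q. c (q, a) = \<mu>)"
          by (rule hurwitz_pair_relation[OF K k finQ _ _ KN _ rel' i(2)]) (use Q2 cop c in \<open>auto simp: I_def\<close>)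
        thus "c i = 0" using i False by auto
      qed
    qed
    moreover have "(\<lambda>(q, a). ?v q a) ` I = (\<Union>q\<in>Q. ?v q ` ?A q)" by (auto simp: I_def)
    moreover have "card I = (\<Sum>q\<in>Q. card (?A q))" unfolding I_def using finQ by (intro card_SigmaI) auto
    ultimately show ?thesis using False by (simp add: span \<epsilon>_def)
  next
    case True
    define z where "z = complex_of_real (hurwitz_zeta k 1)"
    have z0: "z \<noteq> 0" using hurwitz_zeta_pos[of 1 k] k by (simp add: z_def)
    have A1: "1 \<in> ?A q" if "q \<in> Q" for q using Q2[OF that] by (simp add: half_totatives_def)
    have "\<forall>q\<in>Q. \<exists>r. r \<in> \<rat> \<and> r \<noteq> 0 \<and> (\<Sum>a\<in>?A q. ?v q a) = r * z"
      using sum_hurwitz_pair[OF k True] Q2 unfolding z_def by blast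
    then obtain r where r: "\<And>q. q \<in> Q \<Longrightarrow> r q \<in> \<rat>" "\<And>q. q \<in> Q \<Longrightarrow> r q \<noteq> 0"
      "\<And>q. q \<in> Q \<Longrightarrow> (\<Sum>a\<in>?A q. ?v q a) = r q * z" by metis
    have rK: "r q \<in> K" if "q \<in> Q" for q using r(1)[OF that] Rats_subset_subfield[OF K] by auto
    define J where "J = Sigma Q (\<lambda>q. ?A q - {1})"
    have J: "finite J" using finQ by (auto simp: J_def)
    define I where "I = insert None (Some ` J)"
    have I: "finite I" using J by (auto simp: I_def)
    define w where "w = (\<lambda>i. case i of None \<Rightarrow> z | Some (q, a) \<Rightarrow> ?v q a)"
    have w: "w None = z" "w (Some (q, a)) = ?v q a" for q a by (simp_all add: w_def)
    have w': "w (Some i) = ?v (fst i) (snd i)" for i by (cases i) (simp add: w)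
    obtain q1 where q1: "q1 \<in> Q" using Q0 by blast
    have "K_dim K (K_span K (w ` I)) = card I"
    proof (rule K_dim_eq_card[OF K I])
      fix c assume c: "\<And>i. i \<in> I \<Longrightarrow> c i \<in> K" and rel: "(\<Sum>i\<in>I. c i * w i) = 0"
      \<comment> \<open>The coefficient of zeta(k) is spread evenly over the generators of one
        modulus \<open>q1\<close>, whose sum is \<open>r q1\<close> times zeta(k); this leaves a
        relation among generators only.\<close>
      define t where "t = c None / r q1"
      have "c None \<in> K" using c by (simp add: I_def)
      hence tK: "t \<in> K" unfolding t_def by (intro K_closed[OF K] rK q1)
      define d where "d = (\<lambda>q a. (if a = 1 then 0 else c (Some (q, a))) + (if q = q1 then t else 0))"
      have dK: "d q a \<in> K" if "q \<in> Q" "a \<in> ?A q" for q a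
        unfolding d_def using that c tK by (intro K_closed(3)[OF K]) (auto simp: K_closed[OF K] I_def J_def)
      have "(\<Sum>q\<in>Q. \<Sum>a\<in>?A q. d q a * ?v q a)
          = (\<Sum>q\<in>Q. (\<Sum>a\<in>?A q - {1}. c (Some (q, a)) * ?v q a) + (if q = q1 then c None * z else 0))"
      proof (intro sum.cong refl)
        fix q assume q: "q \<in> Q"
        have "(\<Sum>a\<in>?A q. d q a * ?v q a)
            = (\<Sum>a\<in>?A q. (if a = 1 then 0 else c (Some (q, a))) * ?v q a) + (\<Sum>a\<in>?A q. (if q = q1 then t else 0) * ?v q a)"
          by (simp add: d_def distrib_right sum.distrib)
        also have "(\<Sum>a\<in>?A q. (if a = 1 then 0 else c (Some (q, a))) * ?v q a) = (\<Sum>a\<in>?A q - {1}. c (Some (q, a)) * ?v q a)"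
          by (rule sum.mono_neutral_cong_right) auto
        also have "(\<Sum>a\<in>?A q. (if q = q1 then t else 0) * ?v q a) = (if q = q1 then c None * z else 0)"
          using r(2,3)[OF q] by (auto simp: t_def simp flip: sum_distrib_left)
        finally show "(\<Sum>a\<in>?A q. d q a * ?v q a)
          = (\<Sum>a\<in>?A q - {1}. c (Some (q, a)) * ?v q a) + (if q = q1 then c None * z else 0)" .
      qed
      also have "\<dots> = (\<Sum>i\<in>J. c (Some i) * w (Some i)) + c None * z"
        unfolding sum.distrib J_def using finQ q1
        by (subst sum.Sigma) (auto simp: case_prod_unfold w' sum.delta)
      also have "\<dots> = (\<Sum>i\<in>I. c i * w i)"
        unfolding I_def using J by (subst sum.insert) (auto simp: sum.reindex w)
      finally have rel': "(\<Sum>q\<in>Q. \<Sum>a\<in>?A q. d q a * ?v q a) = 0" using rel by simp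
      \<comment> \<open>At the omitted index 1 the coefficient has no contribution from
        \<open>c (Some (q, a))\<close>, so constancy forces all of these to vanish.\<close>
      have const: "d q a = d q 1" if "q \<in> Q" "a \<in> ?A q" for q a
      proof -
        have "\<exists>\<mu>. (odd k \<longrightarrow> \<mu> = 0) \<and> (\<forall>a\<in>?A q. d q a = \<mu>)"
          by (rule hurwitz_pair_relation[OF K k finQ _ _ KN _ rel' that(1)]) (use Q2 cop dK in auto)
        thus ?thesis using that A1[OF that(1)] by metis
      qed
      have cJ: "c (Some i) = 0" if "i \<in> J" for i
      proof -
        obtain q a where i: "i = (q, a)" "q \<in> Q" "a \<in> ?A q" "a \<noteq> 1" using \<open>i \<in> J\<close> by (auto simp: J_def)
        show ?thesis using const[OF i(2,3)] i(1,4) by (simp add: d_def)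
      qed
      have "(\<Sum>i\<in>I. c i * w i) = c None * z + (\<Sum>i\<in>J. c (Some i) * w (Some i))"
        unfolding I_def using J by (subst sum.insert) (auto simp: sum.reindex w)
      hence "c None * z = 0" using rel cJ by simp
      thus "\<forall>i\<in>I. c i = 0" using cJ z0 by (auto simp: I_def)
    qed
    moreover have "K_span K (w ` I) = K_span K (\<Union>q\<in>Q. ?v q ` ?A q)"
    proof (rule K_span_eqI[OF K])
      have "z \<in> K_span K (\<Union>q\<in>Q. ?v q ` ?A q)"
        using Vplus_1_subset[OF K k Q2[OF q1]] True q1 K_span_superset[OF K, of "\<Union>q\<in>Q. Vplus K k q"]
        unfolding span[symmetric] z_def by auto
      moreover have "?v q a \<in> K_span K (\<Union>q\<in>Q. ?v q ` ?A q)" if "q \<in> Q" "a \<in> ?A q" for q a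
        using K_span_superset[OF K, of "\<Union>q\<in>Q. ?v q ` ?A q"] that by blast
      ultimately show "w ` I \<subseteq> K_span K (\<Union>q\<in>Q. ?v q ` ?A q)"
        by (auto simp: I_def J_def w)
      have zw: "z \<in> K_span K (w ` I)"
        using K_span_superset[OF K, of "w ` I"] by (auto simp: I_def w)
      have vw: "?v q a \<in> K_span K (w ` I)" if "q \<in> Q" "a \<in> ?A q - {1}" for q a
      proof -
        have "w (Some (q, a)) \<in> w ` I" using that by (auto simp: I_def J_def)
        thus ?thesis using K_span_superset[OF K, of "w ` I"] by (auto simp: w)
      qed
      have "?v q 1 \<in> K_span K (w ` I)" if "q \<in> Q" for q
      proof -
        have "?v q 1 = r q * z - (\<Sum>a\<in>?A q - {1}. ?v q a)"
          using r(3)[OF that] sum.remove[OF finite_half_totatives A1[OF that], of "?v q"] by (simp add: algebra_simps)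
        also have "\<dots> \<in> K_span K (w ` I)"
          by (intro K_span_diff[OF K] K_span_scale[OF K] K_span_sum[OF K] zw rK that vw)
        finally show ?thesis .
      qed
      thus "(\<Union>q\<in>Q. ?v q ` ?A q) \<subseteq> K_span K (w ` I)" using vw by blast
    qed
    moreover have "card I = Suc (card J)" unfolding I_def using J by (subst card_insert_disjoint) (auto simp: card_image)
    moreover have "card J = (\<Sum>q\<in>Q. card (?A q) - 1)"
      unfolding J_def using finQ A1 by (subst card_SigmaI) auto
    moreover have "int (\<Sum>q\<in>Q. card (?A q) - 1) = (\<Sum>q\<in>Q. int (card (?A q)) - 1)"
      unfolding of_nat_sum
    proof (intro sum.cong refl)
      fix q assume "q \<in> Q"
      hence "card (?A q) > 0" using A1 by (auto simp: card_gt_0_iff)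
      thus "int (card (?A q) - 1) = int (card (?A q)) - 1" by simp
    qed
    ultimately show ?thesis using True by (simp add: span \<epsilon>_def)
  qed
qed

theorem theorem1p10:
  fixes l k :: nat and q :: "nat \<Rightarrow> nat" and K :: "complex set"
  assumes "l \<ge> 1"
    and "\<forall>j\<in>{1..l}. q j \<ge> 1"
    and "\<forall>i\<in>{1..l}. \<forall>j\<in>{1..l}. i \<noteq> j \<longrightarrow> coprime (q i) (q j)"
    and "k > 1"
    and "number_field K"
    and "K \<inter> cyclotomic_plus (\<Prod>j=1..l. q j) = \<rat>"
  shows "int (K_dim K (K_span K (\<Union>j\<in>{1..l}. Vplus K k (q j))))
           = (\<Sum>j=1..l. int (K_dim K (Vplus K k (q j))))
             - (int l - 1) * int (K_dim K (Vplus K k 1))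
       \<and> ((\<forall>j\<in>{1..l}. q j > 2) \<longrightarrow>
         real (K_dim K (K_span K (\<Union>j\<in>{1..l}. Vplus K k (q j))))
           = (\<Sum>j=1..l. real (totient (q j)) / 2) - (real l - 1) / 2 * (1 + (-1) ^ k))
       \<and> (q 1 = 2 \<and> (\<forall>j\<in>{2..l}. q j > 2) \<longrightarrow>
         real (K_dim K (K_span K (\<Union>j\<in>{1..l}. Vplus K k (q j))))
           = (\<Sum>j=2..l. real (totient (q j)) / 2) - (real l - 2) / 2 * (1 + (-1) ^ k))"
proof -
  note k = assms(4)
  have K: "subfield_C K" using assms(5) by (simp add: number_field_def)
  define \<epsilon> where "\<epsilon> = (if even k then 1 else 0 :: int)"
  define N where "N = (\<Prod>j=1..l. q j)"
  define z where "z = (if even k then complex_of_real (hurwitz_zeta k 1) else 0)"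
  have N0: "N > 0" unfolding N_def using assms(2) by (intro prod_pos) fastforce
  have KM: "K \<inter> cyclotomic_plus m = \<rat>" if "m dvd N" for m
  proof
    show "K \<inter> cyclotomic_plus m \<subseteq> \<rat>"
      using cyclotomic_plus_mono[OF that N0] assms(6) unfolding N_def by blast
    show "\<rat> \<subseteq> K \<inter> cyclotomic_plus m"
      using Rats_subset_subfield[OF K] Rats_subset_subfield[OF subfield_cyclotomic_plus] by blast
  qed
  have qN: "q j dvd N" if "j \<in> {1..l}" for j
    unfolding N_def using that by (intro dvd_prodI) auto
  \<comment> \<open>The sum formula for a single modulus, where \<open>\<epsilon>\<close>
    cancels.\<close>
  have dim_large: "int (K_dim K (Vplus K k (q j))) = int (card (half_totatives (q j)))"
    if "j \<in> {1..l}" "q j > 2" for j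
  proof -
    have "int (K_dim K (K_span K (\<Union>q\<in>{q j}. Vplus K k q)))
        = \<epsilon> + (\<Sum>q\<in>{q j}. int (card (half_totatives q)) - \<epsilon>)"
      unfolding \<epsilon>_def by (rule K_dim_sum_Vplus[OF K k]) (use that KM[OF qN] in auto)
    moreover have "K_span K (Vplus K k (q j)) = Vplus K k (q j)"
      unfolding Vplus_eq_span[OF that(2)] by (rule K_span_idem[OF K])
    ultimately show ?thesis by simp
  qed
  have dim_small: "int (K_dim K (Vplus K k m)) = \<epsilon>" if "m \<in> {1, 2}" for m
    using K_dim_Vplus_small[OF K k that] by (simp add: \<epsilon>_def)
  define J where "J = {j\<in>{1..l}. q j > 2}"
  have small: "q j \<in> {1, 2}" if "j \<in> {1..l} - J" for j
  proof -
    have "q j \<ge> 1" "\<not> q j > 2" using that assms(2) by (auto simp: J_def)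
    thus ?thesis by auto
  qed
  have total: "int (K_dim K (K_span K (\<Union>j\<in>{1..l}. Vplus K k (q j))))
      = \<epsilon> + (\<Sum>j=1..l. int (K_dim K (Vplus K k (q j))) - \<epsilon>)"
  proof (cases "J = {}")
    case True
    have V: "Vplus K k (q j) = K_span K {z}" if "j \<in> {1..l}" for j
      unfolding z_def using small[of j] True that by (intro Vplus_small[OF K k]) auto
    have "(\<Union>j\<in>{1..l}. Vplus K k (q j)) = K_span K {z}" using V assms(1) by auto
    hence "K_span K (\<Union>j\<in>{1..l}. Vplus K k (q j)) = K_span K {z}"
      using K_span_idem[OF K] by simp
    also have "\<dots> = Vplus K k 1" unfolding z_def using Vplus_small[OF K k, of 1] by simp
    finally show ?thesis using dim_small small True by simp
  next
    case False
    \<comment> \<open>Coprimality separates only indices with moduli above 1; the value 1 may be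
      repeated among the q j, but it does not occur on \<open>J\<close>.\<close>
    have inj: "inj_on q J"
    proof (rule inj_onI, rule ccontr)
      fix i j assume ij: "i \<in> J" "j \<in> J" "q i = q j" "i \<noteq> j"
      hence "coprime (q i) (q i)" using assms(3) by (metis (no_types, lifting) J_def mem_Collect_eq)
      thus False using ij(1) by (simp add: J_def)
    qed
    have prodJ: "\<Prod>(q ` J) dvd N"
    proof -
      have "\<Prod>(q ` J) = (\<Prod>j\<in>J. q j)" using inj by (simp add: prod.reindex)
      also have "\<dots> dvd N" unfolding N_def by (rule prod_dvd_prod_subset) (auto simp: J_def)
      finally show ?thesis .
    qed
    have "K_span K (\<Union>j\<in>{1..l}. Vplus K k (q j)) = K_span K (\<Union>p\<in>q ` J. Vplus K k p)"
    proof (rule K_span_eqI[OF K])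
      show "(\<Union>p\<in>q ` J. Vplus K k p) \<subseteq> K_span K (\<Union>j\<in>{1..l}. Vplus K k (q j))"
        by (rule order.trans[OF _ K_span_superset[OF K]]) (auto simp: J_def)
      show "(\<Union>j\<in>{1..l}. Vplus K k (q j)) \<subseteq> K_span K (\<Union>p\<in>q ` J. Vplus K k p)"
      proof (rule UN_least)
        fix j assume j: "j \<in> {1..l}"
        show "Vplus K k (q j) \<subseteq> K_span K (\<Union>p\<in>q ` J. Vplus K k p)"
        proof (cases "j \<in> J")
          case True
          thus ?thesis by (intro order.trans[OF _ K_span_superset[OF K]]) auto
        next
          case False
          obtain i where i: "i \<in> J" using \<open>J \<noteq> {}\<close> by blast
          hence "z \<in> Vplus K k (q i)" unfolding z_def by (intro Vplus_1_subset[OF K k]) (auto simp: J_def)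
          hence "z \<in> K_span K (\<Union>p\<in>q ` J. Vplus K k p)"
            using i K_span_superset[OF K, of "\<Union>p\<in>q ` J. Vplus K k p"] by blast
          hence "K_span K {z} \<subseteq> K_span K (\<Union>p\<in>q ` J. Vplus K k p)"
            by (intro K_span_minimal[OF K]) auto
          thus ?thesis using Vplus_small[OF K k small[of j]] False j by (simp add: z_def)
        qed
      qed
    qed
    also have "int (K_dim K \<dots>) = \<epsilon> + (\<Sum>p\<in>q ` J. int (card (half_totatives p)) - \<epsilon>)"
      unfolding \<epsilon>_def
    proof (rule K_dim_sum_Vplus[OF K k])
      show "coprime p r" if pr: "p \<in> q ` J" "r \<in> q ` J" "p \<noteq> r" for p r
      proof -
        obtain i j where "i \<in> J" "j \<in> J" "p = q i" "r = q j" using pr(1,2) by blast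
        moreover from this have "i \<noteq> j" using pr(3) by auto
        ultimately show ?thesis using assms(3) unfolding J_def by blast
      qed
    qed (use False KM[OF prodJ] in \<open>auto simp: J_def\<close>)
    also have "(\<Sum>p\<in>q ` J. int (card (half_totatives p)) - \<epsilon>) = (\<Sum>j\<in>J. int (K_dim K (Vplus K k (q j))) - \<epsilon>)"
      unfolding sum.reindex[OF inj] by (intro sum.cong) (auto simp: J_def dim_large)
    also have "\<dots> = (\<Sum>j=1..l. int (K_dim K (Vplus K k (q j))) - \<epsilon>)"
      using small dim_small by (intro sum.mono_neutral_left) (auto simp: J_def)
    finally show ?thesis .
  qed
  have first: "int (K_dim K (K_span K (\<Union>j\<in>{1..l}. Vplus K k (q j))))
           = (\<Sum>j=1..l. int (K_dim K (Vplus K k (q j)))) - (int l - 1) * \<epsilon>"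
    unfolding total by (simp add: sum_subtractf algebra_simps)
  have \<epsilon>: "real_of_int \<epsilon> = (1 + (-1) ^ k) / 2" by (simp add: \<epsilon>_def)
  have first_real: "real (K_dim K (K_span K (\<Union>j\<in>{1..l}. Vplus K k (q j))))
           = (\<Sum>j=1..l. real (K_dim K (Vplus K k (q j)))) - (real l - 1) * real_of_int \<epsilon>"
    using arg_cong[OF first, of real_of_int] by simp
  have dim_real: "real (K_dim K (Vplus K k (q j))) = real (totient (q j)) / 2" if "j \<in> {1..l}" "q j > 2" for j
    using dim_large[OF that] card_half_totatives[OF that(2)] by simp
  show ?thesis
  proof (intro conjI impI)
    show "int (K_dim K (K_span K (\<Union>j\<in>{1..l}. Vplus K k (q j))))
           = (\<Sum>j=1..l. int (K_dim K (Vplus K k (q j)))) - (int l - 1) * int (K_dim K (Vplus K k 1))"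
      using first dim_small[of 1] by simp
  next
    assume "\<forall>j\<in>{1..l}. q j > 2"
    hence "(\<Sum>j=1..l. real (K_dim K (Vplus K k (q j)))) = (\<Sum>j=1..l. real (totient (q j)) / 2)"
      by (intro sum.cong refl dim_real) auto
    thus "real (K_dim K (K_span K (\<Union>j\<in>{1..l}. Vplus K k (q j))))
           = (\<Sum>j=1..l. real (totient (q j)) / 2) - (real l - 1) / 2 * (1 + (-1) ^ k)"
      unfolding first_real \<epsilon> by simp
  next
    assume q: "q 1 = 2 \<and> (\<forall>j\<in>{2..l}. q j > 2)"
    \<comment> \<open>The modulus 2 contributes \<open>\<epsilon>\<close>, which turns the
      correction (l - 1) \<open>\<epsilon>\<close> into (l - 2) \<open>\<epsilon>\<close>.\<close>
    have "(\<Sum>j=1..l. real (K_dim K (Vplus K k (q j))))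
        = real (K_dim K (Vplus K k (q 1))) + (\<Sum>j=2..l. real (K_dim K (Vplus K k (q j))))"
      using sum.atLeast_Suc_atMost[OF assms(1)] by (simp add: numeral_2_eq_2)
    also have "real (K_dim K (Vplus K k (q 1))) = real_of_int \<epsilon>"
      using dim_small[of 2] q by (metis insertI1 insert_commute of_int_of_nat_eq)
    also have "(\<Sum>j=2..l. real (K_dim K (Vplus K k (q j)))) = (\<Sum>j=2..l. real (totient (q j)) / 2)"
      using q by (intro sum.cong refl dim_real) auto
    finally show "real (K_dim K (K_span K (\<Union>j\<in>{1..l}. Vplus K k (q j))))
           = (\<Sum>j=2..l. real (totient (q j)) / 2) - (real l - 2) / 2 * (1 + (-1) ^ k)"
      unfolding first_real \<epsilon> by (simp add: field_simps)
  qed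
qed

end
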